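(* For every $n \geq 6$ there exists an irreducible valuation $v \in \mathcal{GSV}_n$ which does not belong to the smallest subset of $\mathcal{GSV}_n$ that contains all weighted ranks of matroids and all partition valuations whose ground sets are subsets of $[n]$ and that is closed under merging and endowment.
   Context: Let $[n]=\{1,\dots,n\}$. A valuation with ground set $E \subseteq [n]$ is a function $u: 2^E \to \mathbb{R}_{\geq 0}$ with $u(\emptyset)=0$ and $u(S)\le u(T)$ whenever $S \subseteq T$; two valuations are equal only if they have the same ground set and agree everywhere. For $p \in \mathbb{R}^E$ let $D(u,p)=\arg\max_{S \subseteq E}\big(u(S)-\sum_{i\in S}p_i\big)$; $u$ is gross substitutes if for all $p \le q$ in $\mathbb{R}^E$ and every $S \in D(u,p)$ there is $T \in D(u,q)$ with $\{i \in S: p_i=q_i\}\subseteq T$. $\mathcal{GSV}_n$ is the set of gross substitutes valuations whose ground set is a subset of $[n]$. Merging: for valuations $u^1$ on $E^1$ and $u^2$ on $E^2$, $(u^1\ast u^2)(S)=\max\{u^1(T)+u^2(S\setminus T): T \subseteq S\cap E^1,\ S\setminus T \subseteq E^2\}$ for $S\subseteq E^1\cup E^2$. Endowment: for $u$ on $E$ and $T\subseteq E$, $\partial^T u(S)=u(S\cup T)-u(T)$ for $S\subseteq E\setminus T$. A valuation $v\in\mathcal{GSV}_n$ is irreducible if $v=u\ast u'$ with $u,u'\in\mathcal{GSV}_n$ implies $v=u$ or $v=u'$. The weighted rank of a matroid on $E$ with independent sets $\mathcal{I}$ and weights $w\in\mathbb{R}^E_{\ge0}$ is $\rho^w(T)=\max\{\sum_{i\in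 I}w_i: I\in\mathcal{I}, I\subseteq T\}$. For a set partition $\pi=\{\pi_1,\dots,\pi_m\}$ of a set $S$ and reals $0<a<b<2a$, the partition valuation $v^{\pi,a,b}$ on $S$ is given by $v(\emptyset)=0$, $v(I)=a$ if $\emptyset\ne I\subseteq\pi_r$ for some $r$, and $v(I)=b$ otherwise. *)

theory Defs
  imports Complex_Main "HOL-Library.FuncSet" "HOL-Library.Disjoint_Sets"
begin

text \<open>
  A valuation is a pair of its ground set \<open>E\<close> and a set function that is extensional on
  \<open>Pow E\<close>, so that HOL equality of pairs is equality of ground sets and of all values on
  subsets of \<open>E\<close>.
\<close>

type_synonym setfun = "nat set \<times> (nat set \<Rightarrow> real)"

definition valuation_on :: "nat set \<Rightarrow> (nat set \<Rightarrow> real) \<Rightarrow> bool" where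
  "valuation_on E u \<longleftrightarrow>
     u \<in> Pow E \<rightarrow>\<^sub>E {0..} \<and> u {} = 0 \<and> (\<forall>S T. S \<subseteq> T \<and> T \<subseteq> E \<longrightarrow> u S \<le> u T)"

text \<open>
  Price vectors in \<open>\<real>\<^sup>E\<close> are total functions; only their values on \<open>E\<close> are ever used.
\<close>

definition demand :: "nat set \<Rightarrow> (nat set \<Rightarrow> real) \<Rightarrow> (nat \<Rightarrow> real) \<Rightarrow> nat set set" where
  "demand E u p = {S. is_arg_max (\<lambda>S. u S - (\<Sum>i\<in>S. p i)) (\<lambda>S. S \<subseteq> E) S}"

definition gross_substitutes :: "nat set \<Rightarrow> (nat set \<Rightarrow> real) \<Rightarrow> bool" where
  "gross_substitutes E u \<longleftrightarrow>
     (\<forall>p q. (\<forall>i\<in>E. p i \<le> q i) \<longrightarrow>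
       (\<forall>S\<in>demand E u p. \<exists>T\<in>demand E u q. {i\<in>S. p i = q i} \<subseteq> T))"

definition GSV :: "nat \<Rightarrow> setfun set" where
  "GSV n = {(E, u). E \<subseteq> {1..n} \<and> valuation_on E u \<and> gross_substitutes E u}"

fun merge :: "setfun \<Rightarrow> setfun \<Rightarrow> setfun" where
  "merge (E1, u1) (E2, u2) =
     (E1 \<union> E2,
      \<lambda>S\<in>Pow (E1 \<union> E2). Max {u1 T + u2 (S - T) | T. T \<subseteq> S \<inter> E1 \<and> S - T \<subseteq> E2})"

fun endow :: "nat set \<Rightarrow> setfun \<Rightarrow> setfun" where
  "endow T (E, u) = (E - T, \<lambda>S\<in>Pow (E - T). u (S \<union> T) - u T)"

definition irreducible_valuation :: "nat \<Rightarrow> setfun \<Rightarrow> bool" where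
  "irreducible_valuation n v \<longleftrightarrow>
     v \<in> GSV n \<and> (\<forall>u\<in>GSV n. \<forall>u'\<in>GSV n. v = merge u u' \<longrightarrow> v = u \<or> v = u')"

definition matroid :: "nat set \<Rightarrow> nat set set \<Rightarrow> bool" where
  "matroid E \<I> \<longleftrightarrow>
     finite E \<and> \<I> \<subseteq> Pow E \<and> {} \<in> \<I> \<and>
     (\<forall>I\<in>\<I>. \<forall>J. J \<subseteq> I \<longrightarrow> J \<in> \<I>) \<and>
     (\<forall>I\<in>\<I>. \<forall>J\<in>\<I>. card I < card J \<longrightarrow> (\<exists>x\<in>J - I. insert x I \<in> \<I>))"

definition weighted_rank :: "nat set \<Rightarrow> nat set set \<Rightarrow> (nat \<Rightarrow> real) \<Rightarrow> setfun" where
  "weighted_rank E \<I> w = (E, \<lambda>T\<in>Pow E. Max {\<Sum>i\<in>I. w i | I. I \<in> \<I> \<and> I \<subseteq> T})"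

definition weighted_ranks :: "nat \<Rightarrow> setfun set" where
  "weighted_ranks n =
     {weighted_rank E \<I> w | E \<I> w. E \<subseteq> {1..n} \<and> matroid E \<I> \<and> (\<forall>i\<in>E. 0 \<le> w i)}"

definition partition_valuation :: "nat set \<Rightarrow> nat set set \<Rightarrow> real \<Rightarrow> real \<Rightarrow> setfun" where
  "partition_valuation S \<pi> a b =
     (S, \<lambda>I\<in>Pow S. if I = {} then 0 else if \<exists>B\<in>\<pi>. I \<subseteq> B then a else b)"

definition partition_valuations :: "nat \<Rightarrow> setfun set" where
  "partition_valuations n =
     {partition_valuation S \<pi> a b | S \<pi> a b.
        S \<subseteq> {1..n} \<and> partition_on S \<pi> \<and> 0 < a \<and> a < b \<and> b < 2 * a}"

definition closed_under_merging :: "setfun set \<Rightarrow> bool" where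
  "closed_under_merging X \<longleftrightarrow> (\<forall>u\<in>X. \<forall>u'\<in>X. merge u u' \<in> X)"

definition closed_under_endowment :: "setfun set \<Rightarrow> bool" where
  "closed_under_endowment X \<longleftrightarrow> (\<forall>u\<in>X. \<forall>T. T \<subseteq> fst u \<longrightarrow> endow T u \<in> X)"

definition generated_valuations :: "nat \<Rightarrow> setfun set" where
  "generated_valuations n =
     \<Inter> {X. X \<subseteq> GSV n \<and> weighted_ranks n \<subseteq> X \<and> partition_valuations n \<subseteq> X \<and>
             closed_under_merging X \<and> closed_under_endowment X}"

end

theory Submission imports Defs begin

text \<open>
  Let \<open>v S = 1 - 1 / 2 ^ k\<close> where \<open>k\<close> is the number of residues modulo 3 met by \<open>S\<close>. If \<open>v\<close> is the
  merge of two factors then, since single items are worth 1/2 and pairs less than 1, one factor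
  values all single items at 1/2. Every item has a parallel one, of the same residue, so the other
  factor vanishes on single items and hence everywhere, because gross substitutes implies
  submodularity. Since \<open>v\<close> lives on the full ground set, it is not a proper endowment either, and it
  is neither a weighted rank nor a partition valuation; thus \<open>GSV n - {v}\<close> is a closed family as
  soon as \<open>GSV n\<close> is one.

  Weighted ranks and concave functions of a number of colours, among them the partition valuations
  and \<open>v\<close>, are M-natural-concave, which implies gross substitutes. A merge is obtained from a direct
  sum, in which the shared items occur twice, by identifying the two copies of one item at a time,
  and each such step preserves gross substitutes.
\<close>

section \<open>Demand and gross substitutes over an arbitrary type of items\<close>

text \<open>Merges are studied on two disjoint copies of the items, hence the polymorphic counterparts of
  \<^const>\<open>demand\<close> and \<^const>\<open>gross_substitutes\<close>.\<close>

definition demanded :: "'a set \<Rightarrow> ('a set \<Rightarrow> real) \<Rightarrow> ('a \<Rightarrow> real) \<Rightarrow> 'a set set" where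
  "demanded E u p = {S. S \<subseteq> E \<and> (\<forall>T\<subseteq>E. u T - sum p T \<le> u S - sum p S)}"

definition substitutes :: "'a set \<Rightarrow> ('a set \<Rightarrow> real) \<Rightarrow> bool" where
  "substitutes E u \<longleftrightarrow> (\<forall>p q. (\<forall>i\<in>E. p i \<le> q i) \<longrightarrow>
     (\<forall>S\<in>demanded E u p. \<exists>T\<in>demanded E u q. {i\<in>S. p i = q i} \<subseteq> T))"

lemma gross_substitutes_iff_substitutes: "gross_substitutes E u \<longleftrightarrow> substitutes E u"
proof -
  have "demand E u = demanded E u"
    by (auto simp: fun_eq_iff demand_def demanded_def is_arg_max_def not_less)
  then show ?thesis by (simp add: gross_substitutes_def substitutes_def)
qed

lemma demandedI:
  assumes "S \<subseteq> E" "\<And>T. T \<subseteq> E \<Longrightarrow> u T - sum p T \<le> u S - sum p S"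
  shows "S \<in> demanded E u p"
  using assms by (auto simp: demanded_def)

lemma
  assumes "S \<in> demanded E u p"
  shows demanded_subset: "S \<subseteq> E"
    and demanded_maximal: "\<And>T. T \<subseteq> E \<Longrightarrow> u T - sum p T \<le> u S - sum p S"
  using assms by (auto simp: demanded_def)

lemma substitutesI:
  assumes "\<And>p q S. \<lbrakk>\<And>i. i \<in> E \<Longrightarrow> p i \<le> q i; S \<in> demanded E u p\<rbrakk>
             \<Longrightarrow> \<exists>T\<in>demanded E u q. {i\<in>S. p i = q i} \<subseteq> T"
  shows "substitutes E u"
  using assms unfolding substitutes_def by blast

lemma substitutesE:
  assumes "substitutes E u" "S \<in> demanded E u p" "\<And>i. i \<in> E \<Longrightarrow> p i \<le> q i"
  obtains T where "T \<in> demanded E u q" "{i\<in>S. p i = q i} \<subseteq> T"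
  using assms unfolding substitutes_def by blast

lemma demanded_cong:
  assumes "\<And>S. S \<subseteq> E \<Longrightarrow> u S = u' S"
  shows "demanded E u = demanded E u'"
  using assms by (auto simp: demanded_def fun_eq_iff)

lemma substitutes_cong:
  assumes "\<And>S. S \<subseteq> E \<Longrightarrow> u S = u' S"
  shows "substitutes E u \<longleftrightarrow> substitutes E u'"
  unfolding substitutes_def using demanded_cong[of E u u', OF assms] by simp

lemma demanded_nonempty:
  assumes "finite E"
  obtains S where "S \<in> demanded E u p"
proof -
  obtain S where "is_arg_min (\<lambda>S. sum p S - u S) (\<lambda>S. S \<in> Pow E) S"
    using ex_is_arg_min_if_finite[of "Pow E"] assms by blast
  then have "S \<in> demanded E u p" by (auto simp: is_arg_min_linorder demanded_def algebra_simps)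
  then show thesis by (rule that)
qed

lemma demanded_if_ge:
  assumes "S \<in> demanded E u p" "T \<subseteq> E" "u S - sum p S \<le> u T - sum p T"
  shows "T \<in> demanded E u p"
  using assms by (auto simp: demanded_def intro: order_trans)

lemma demanded_if_exchange:
  assumes S: "S \<in> demanded E u p" and T: "T \<in> demanded E u q" and sub: "S' \<subseteq> E" "T' \<subseteq> E"
    and "u S + u T \<le> u S' + u T'" "sum p S' + sum q T' \<le> sum p S + sum q T"
  shows "T' \<in> demanded E u q"
proof (rule demanded_if_ge[OF T sub(2)])
  show "u T - sum q T \<le> u T' - sum q T'"
    using demanded_maximal[OF S sub(1)] assms(5,6) by linarith
qed

text \<open>Raising the price of \<^term>\<open>x\<close> leaves exactly the demanded sets that avoid \<^term>\<open>x\<close>.\<close>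

lemma substitutes_drop_item:
  assumes fin: "finite E" and sb: "substitutes E u"
    and T: "T \<in> demanded E u p" and U: "U \<in> demanded E u p" "x \<notin> U"
  obtains T' where "T' \<in> demanded E u p" "T - {x} \<subseteq> T'" "x \<notin> T'"
proof -
  define q where "q i = p i + of_bool (i = x)" for i
  obtain T' where T': "T' \<in> demanded E u q" "{i\<in>T. p i = q i} \<subseteq> T'"
    by (rule substitutesE[OF sb T, of q]) (auto simp: q_def)
  have sum_q: "sum q A = sum p A + of_bool (x \<in> A)" if "A \<subseteq> E" for A
    using finite_subset[OF that fin] by (simp add: q_def sum.distrib of_bool_def)
  have sub: "U \<subseteq> E" "T' \<subseteq> E" using demanded_subset U(1) T'(1) by blast+
  have "u U - sum q U \<le> u T' - sum q T'" using demanded_maximal[OF T'(1) sub(1)] .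
  then have le: "u U - sum p U + of_bool (x \<in> T') \<le> u T' - sum p T'"
    using U(2) sum_q[OF sub(1)] sum_q[OF sub(2)] by simp
  have "T' \<in> demanded E u p"
    by (rule demanded_if_ge[OF U(1) sub(2)]) (use le in \<open>simp add: of_bool_def split: if_splits\<close>)
  moreover have "x \<notin> T'"
    using le demanded_maximal[OF U(1) sub(2)] by (simp add: of_bool_def split: if_splits)
  moreover have "T - {x} \<subseteq> T'" using T'(2) by (auto simp: q_def)
  ultimately show thesis using that by blast
qed

section \<open>M-natural-concave valuations\<close>

definition M_natural_concave :: "'a set \<Rightarrow> ('a set \<Rightarrow> real) \<Rightarrow> bool" where
  "M_natural_concave E u \<longleftrightarrow> (\<forall>S T i. S \<subseteq> E \<longrightarrow> T \<subseteq> E \<longrightarrow> i \<in> S - T \<longrightarrow>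
     u S + u T \<le> u (S - {i}) + u (insert i T) \<or>
     (\<exists>j\<in>T - S. u S + u T \<le> u (insert j (S - {i})) + u (insert i (T - {j}))))"

lemma M_natural_concaveI:
  assumes "\<And>S T i. \<lbrakk>S \<subseteq> E; T \<subseteq> E; i \<in> S; i \<notin> T\<rbrakk> \<Longrightarrow>
     u S + u T \<le> u (S - {i}) + u (insert i T) \<or>
     (\<exists>j\<in>T - S. u S + u T \<le> u (insert j (S - {i})) + u (insert i (T - {j})))"
  shows "M_natural_concave E u"
  using assms unfolding M_natural_concave_def by simp

lemma M_natural_concaveE:
  assumes "M_natural_concave E u" "S \<subseteq> E" "T \<subseteq> E" "i \<in> S" "i \<notin> T"
  obtains (move) "u S + u T \<le> u (S - {i}) + u (insert i T)"
    | (swap) j where "j \<in> T" "j \<notin> S"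
        "u S + u T \<le> u (insert j (S - {i})) + u (insert i (T - {j}))"
  using assms unfolding M_natural_concave_def by blast

lemma M_natural_concave_demanded_exchange:
  assumes fin: "finite E" and concave: "M_natural_concave E u"
    and pq: "\<And>i. i \<in> E \<Longrightarrow> p i \<le> q i" and S: "S \<in> demanded E u p" and T: "T \<in> demanded E u q"
    and i: "i \<in> S" "i \<notin> T" "p i = q i"
  obtains T' where "T' \<in> demanded E u q" "insert i (S \<inter> T) \<subseteq> T'"
proof -
  have SE: "S \<subseteq> E" and TE: "T \<subseteq> E" using demanded_subset S T by blast+
  note finS = finite_subset[OF SE fin] and finT = finite_subset[OF TE fin]
  have iE: "i \<in> E" using SE i(1) by blast
  show thesis
    using concave SE TE i(1,2)
  proof (cases rule: M_natural_concaveE)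
    case move
    then have "insert i T \<in> demanded E u q"
      by (rule demanded_if_exchange[OF S T, rotated 2])
        (use SE TE i finS finT iE in \<open>auto simp: sum_diff1\<close>)
    then show thesis using that by blast
  next
    case (swap j)
    have "p j \<le> q j" using pq TE swap(1) by blast
    with swap have "insert i (T - {j}) \<in> demanded E u q"
      by (intro demanded_if_exchange[OF S T, of "insert j (S - {i})"])
        (use SE TE i finS finT iE in \<open>auto simp: sum_diff1\<close>)
    then show thesis using that swap(2) by blast
  qed
qed

text \<open>Among the sets demanded at the higher prices, one that misses as few items of unchanged price
  as possible misses none.\<close>

lemma substitutes_if_M_natural_concave:
  assumes fin: "finite E" and concave: "M_natural_concave E u"
  shows "substitutes E u"
proof (rule substitutesI)
  fix p q :: "'a \<Rightarrow> real" and S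
  assume pq: "\<And>i. i \<in> E \<Longrightarrow> p i \<le> q i" and S: "S \<in> demanded E u p"
  define kept where "kept = {i\<in>S. p i = q i}"
  have fin_kept: "finite kept"
    using finite_subset[OF demanded_subset[OF S] fin] by (simp add: kept_def)
  obtain T where T: "T \<in> demanded E u q"
    and least: "\<And>T'. T' \<in> demanded E u q \<Longrightarrow> card (kept - T) \<le> card (kept - T')"
    using ex_has_least_nat[of "\<lambda>T. T \<in> demanded E u q" _ "\<lambda>T. card (kept - T)"]
      demanded_nonempty[OF fin] by metis
  have "kept \<subseteq> T"
  proof (rule ccontr)
    assume "\<not> kept \<subseteq> T"
    then obtain i where i: "i \<in> S" "i \<notin> T" "p i = q i" by (auto simp: kept_def)
    obtain T' where T': "T' \<in> demanded E u q" "insert i (S \<inter> T) \<subseteq> T'"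
      using M_natural_concave_demanded_exchange[OF fin concave _ S T i] pq by blast
    have "kept - T' \<subset> kept - T" using T'(2) i by (auto simp: kept_def)
    then have "card (kept - T') < card (kept - T)"
      using fin_kept by (intro psubset_card_mono) simp_all
    then show False using least[OF T'(1)] by simp
  qed
  then show "\<exists>T\<in>demanded E u q. {i\<in>S. p i = q i} \<subseteq> T" using T kept_def by blast
qed

definition discretely_concave :: "(nat \<Rightarrow> real) \<Rightarrow> bool" where
  "discretely_concave g \<longleftrightarrow> (\<forall>k l. k \<le> l \<longrightarrow> g (Suc l) - g l \<le> g (Suc k) - g k)"

lemma M_natural_concave_concave_card:
  assumes fin: "finite E" and concave: "discretely_concave g"
  shows "M_natural_concave E (\<lambda>S. g (card S))"
proof (rule M_natural_concaveI)
  fix S T i assume SE: "S \<subseteq> E" and TE: "T \<subseteq> E" and i: "i \<in> S" "i \<notin> T"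
  note finS = finite_subset[OF SE fin] and finT = finite_subset[OF TE fin]
  have cS: "card S = Suc (card (S - {i}))" using card.remove[OF finS i(1)] .
  show "g (card S) + g (card T) \<le> g (card (S - {i})) + g (card (insert i T)) \<or>
     (\<exists>j\<in>T - S. g (card S) + g (card T) \<le>
        g (card (insert j (S - {i}))) + g (card (insert i (T - {j}))))"
  proof (cases "card T < card S")
    case True
    then have "card T \<le> card (S - {i})" using cS by simp
    then have "g (card S) - g (card (S - {i})) \<le> g (Suc (card T)) - g (card T)"
      using concave cS by (simp add: discretely_concave_def)
    then show ?thesis using i(2) finT by simp
  next
    case False
    have "\<not> T \<subseteq> S" using False psubset_card_mono[OF finS, of T] i by blast
    then obtain j where j: "j \<in> T" "j \<notin> S" by blast
    have "card (insert j (S - {i})) = card S" using j(2) cS finS by simp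
    moreover have "card (insert i (T - {j})) = card T"
      using card.remove[OF finT j(1)] i(2) finT by simp
    ultimately show ?thesis using j by (intro disjI2 bexI[of _ j]) auto
  qed
qed

lemma M_natural_concave_image:
  assumes concave: "M_natural_concave (c ` E) u"
    and mono: "\<And>A B. A \<subseteq> B \<Longrightarrow> B \<subseteq> c ` E \<Longrightarrow> u A \<le> u B"
  shows "M_natural_concave E (\<lambda>S. u (c ` S))"
proof (rule M_natural_concaveI)
  fix S T i assume SE: "S \<subseteq> E" and TE: "T \<subseteq> E" and i: "i \<in> S" "i \<notin> T"
  have up: "u A + u B \<le> u (c ` A') + u (c ` B')"
    if "A \<subseteq> c ` A'" "B \<subseteq> c ` B'" "A' \<subseteq> E" "B' \<subseteq> E" for A B A' B'
    using that by (intro add_mono mono) auto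
  consider (repeated) "c i \<in> c ` (S - {i})"
    | (shared) j where "c i \<notin> c ` (S - {i})" "j \<in> T" "c j = c i"
    | (fresh) "c i \<notin> c ` (S - {i})" "c i \<notin> c ` T" by (metis imageE)
  then show "u (c ` S) + u (c ` T) \<le> u (c ` (S - {i})) + u (c ` insert i T) \<or>
     (\<exists>j\<in>T - S. u (c ` S) + u (c ` T) \<le>
        u (c ` insert j (S - {i})) + u (c ` insert i (T - {j})))"
  proof cases
    case repeated
    then have "c ` S \<subseteq> c ` (S - {i})" 
      by (metis image_insert insert_Diff i(1) insert_absorb order_refl)
    then show ?thesis using SE TE i by (intro disjI1 up) auto
  next
    case (shared j)
    then have "j \<notin> S" using i by (metis DiffI image_eqI singletonD)
    moreover have "c ` S \<subseteq> c ` insert j (S - {i})" "c ` T \<subseteq> c ` insert i (T - {j})"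
      using shared(3) by force+
    ultimately show ?thesis using SE TE i shared(2) by (intro disjI2 bexI[of _ j] up) auto
  next
    case fresh
    have cS: "c ` (S - {i}) = c ` S - {c i}" using fresh(1) by blast
    have "c ` S \<subseteq> c ` E" "c ` T \<subseteq> c ` E" "c i \<in> c ` S" using SE TE i by auto
    with concave show ?thesis using fresh(2)
    proof (cases rule: M_natural_concaveE)
      case move
      then show ?thesis by (simp add: cS)
    next
      case (swap y)
      then obtain j where j: "j \<in> T" "y = c j" by blast
      have "j \<notin> S" using swap(2) j(2) by blast
      moreover have "u (insert y (c ` S - {c i})) + u (insert (c i) (c ` T - {y}))
          \<le> u (c ` insert j (S - {i})) + u (c ` insert i (T - {j}))"
        using SE TE i j by (intro up) (auto simp: cS)
      ultimately show ?thesis using swap(3) j(1) by (intro disjI2 bexI[of _ j]) auto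
    qed
  qed
qed

lemma M_natural_concave_colour_count:
  assumes "finite E" "mono g" "discretely_concave g"
  shows "M_natural_concave E (\<lambda>S. g (card (c ` S)))"
proof (rule M_natural_concave_image)
  show "M_natural_concave (c ` E) (\<lambda>A. g (card A))"
    using assms by (intro M_natural_concave_concave_card) auto
  fix A B assume "A \<subseteq> B" "B \<subseteq> c ` E"
  then show "g (card A) \<le> g (card B)"
    using assms(1) by (intro monoD[OF assms(2)] card_mono) (auto intro: finite_subset)
qed

section \<open>Weighted matroid ranks\<close>

lemma
  assumes "matroid E \<I>"
  shows matroid_finite_ground: "finite E"
    and matroid_empty: "{} \<in> \<I>"
    and matroid_finite: "\<And>A. A \<in> \<I> \<Longrightarrow> finite A"
    and matroid_hereditary: "\<And>A B. A \<in> \<I> \<Longrightarrow> B \<subseteq> A \<Longrightarrow> B \<in> \<I>"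
    and matroid_augment:
      "\<And>A B. A \<in> \<I> \<Longrightarrow> B \<in> \<I> \<Longrightarrow> card A < card B \<Longrightarrow> \<exists>x\<in>B - A. insert x A \<in> \<I>"
  using assms by (auto simp: matroid_def intro: finite_subset)

lemma matroid_extend:
  assumes M: "matroid E \<I>" and A: "A \<in> \<I>" and B: "B \<in> \<I>" and le: "card A \<le> card B"
  obtains A' where "A' \<in> \<I>" "A \<subseteq> A'" "A' \<subseteq> A \<union> B" "card A' = card B"
proof -
  have "\<exists>A'\<in>\<I>. A \<subseteq> A' \<and> A' \<subseteq> A \<union> B \<and> card A' = card B"
    using A le
  proof (induction "card B - card A" arbitrary: A)
    case 0
    then show ?case by auto
  next
    case (Suc k)
    then have "card A < card B" by simp
    then obtain x where x: "x \<in> B - A" "insert x A \<in> \<I>"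
      using matroid_augment[OF M Suc.prems(1) B] by blast
    have "card (insert x A) = Suc (card A)" using x matroid_finite[OF M Suc.prems(1)] by simp
    then obtain A' where "A' \<in> \<I>" "insert x A \<subseteq> A'" "A' \<subseteq> insert x A \<union> B" "card A' = card B"
      using Suc.hyps(1)[of "insert x A"] Suc.hyps(2) x(2) by force
    then show ?case using x(1) by blast
  qed
  then show thesis using that by blast
qed

definition fundamental_circuit :: "'a set set \<Rightarrow> 'a \<Rightarrow> 'a set \<Rightarrow> 'a set" where
  "fundamental_circuit \<I> i J = insert i {j\<in>J. insert i (J - {j}) \<in> \<I>}"

lemma fundamental_circuit_dependent:
  assumes M: "matroid E \<I>" and J: "J \<in> \<I>" and i: "i \<notin> J" and dep: "insert i J \<notin> \<I>"
  shows "fundamental_circuit \<I> i J \<notin> \<I>"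
proof
  define K where "K = {j\<in>J. insert i (J - {j}) \<in> \<I>}"
  note finJ = matroid_finite[OF M J]
  assume "fundamental_circuit \<I> i J \<in> \<I>"
  then have indep: "insert i K \<in> \<I>" by (simp add: fundamental_circuit_def K_def)
  then have "K \<subset> J" using dep by (auto simp: K_def)
  then have "card (insert i K) \<le> card J"
    using psubset_card_mono[OF finJ] finite_subset[OF _ finJ, of K] i
    by (auto simp: card_insert_if Suc_le_eq)
  then obtain A where A: "A \<in> \<I>" "insert i K \<subseteq> A" "A \<subseteq> insert i K \<union> J" "card A = card J"
    using matroid_extend[OF M indep J] by blast
  have "\<not> J \<subseteq> A" using matroid_hereditary[OF M A(1), of "insert i J"] A(2) dep by blast
  then obtain j where j: "j \<in> J" "j \<notin> A" by blast
  have "A \<subseteq> insert i (J - {j})" using A(3) j(2) \<open>K \<subset> J\<close> by blast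
  moreover have "card (insert i (J - {j})) = card A"
    using card.remove[OF finJ j(1)] A(4) i finJ by simp
  ultimately have "A = insert i (J - {j})" using finJ by (intro card_subset_eq) auto
  then have "j \<in> K" using A(1) j(1) by (simp add: K_def)
  then show False using A(2) j(2) by blast
qed

lemma matroid_symmetric_exchange:
  assumes M: "matroid E \<I>" and I: "I \<in> \<I>" and J: "J \<in> \<I>" and i: "i \<in> I" "i \<notin> J"
    and dep: "insert i J \<notin> \<I>"
  obtains j where "j \<in> J" "j \<notin> I" "insert j (I - {i}) \<in> \<I>" "insert i (J - {j}) \<in> \<I>"
proof (rule ccontr)
  note exchangeable = that
  assume none: "\<not> thesis"
  define K where "K = {j\<in>J. insert i (J - {j}) \<in> \<I>}"
  have circuit: "insert i K \<notin> \<I>"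
    using fundamental_circuit_dependent[OF M J i(2) dep]
    by (simp add: fundamental_circuit_def K_def)
  have Ii: "I - {i} \<in> \<I>" using matroid_hereditary[OF M I] by blast
  have maximal: "card A < card I" if A: "A \<in> \<I>" "A \<subseteq> (I - {i}) \<union> K" for A
  proof (rule ccontr)
    assume "\<not> card A < card I"
    then have "card (I - {i}) < card A"
      using card.remove[OF matroid_finite[OF M I] i(1)] by simp
    then obtain x where "x \<in> A - (I - {i})" "insert x (I - {i}) \<in> \<I>"
      using matroid_augment[OF M Ii A(1)] by blast
    then show False using A(2) i none exchangeable[of x] by (auto simp: K_def)
  qed
  have "K \<in> \<I>" using matroid_hereditary[OF M J] by (auto simp: K_def)
  moreover from this have "card K \<le> card I" using maximal[of K] by simp
  ultimately obtain A where A: "A \<in> \<I>" "K \<subseteq> A" "A \<subseteq> K \<union> I" "card A = card I"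
    using matroid_extend[OF M _ I] by blast
  have "\<not> A \<subseteq> (I - {i}) \<union> K" using maximal[OF A(1)] A(4) by auto
  then have "i \<in> A" using A(3) by blast
  then show False using circuit matroid_hereditary[OF M A(1), of "insert i K"] A(2) by blast
qed

definition max_weight :: "'a set set \<Rightarrow> ('a \<Rightarrow> real) \<Rightarrow> 'a set \<Rightarrow> real" where
  "max_weight \<I> w T = Max {\<Sum>i\<in>I. w i | I. I \<in> \<I> \<and> I \<subseteq> T}"

lemma max_weight_ge:
  assumes "finite T" "I \<in> \<I>" "I \<subseteq> T"
  shows "sum w I \<le> max_weight \<I> w T"
  unfolding max_weight_def using assms by (intro Max_ge) auto

lemma max_weight_attained:
  assumes "finite T" "{} \<in> \<I>"
  obtains I where "I \<in> \<I>" "I \<subseteq> T" "max_weight \<I> w T = sum w I"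
proof -
  have "max_weight \<I> w T \<in> {sum w I | I. I \<in> \<I> \<and> I \<subseteq> T}"
    unfolding max_weight_def using assms by (intro Max_in) auto
  then show thesis using that by blast
qed

lemma max_weight_mono:
  assumes "finite T" "{} \<in> \<I>" "S \<subseteq> T"
  shows "max_weight \<I> w S \<le> max_weight \<I> w T"
proof -
  obtain I where "I \<in> \<I>" "I \<subseteq> S" "max_weight \<I> w S = sum w I"
    using max_weight_attained[OF finite_subset[OF assms(3,1)] assms(2)] .
  then show ?thesis using max_weight_ge[OF assms(1), of I \<I> w] assms(3) by simp
qed

lemma M_natural_concave_max_weight:
  assumes M: "matroid E \<I>"
  shows "M_natural_concave E (max_weight \<I> w)" (is "M_natural_concave E ?f")
proof (rule M_natural_concaveI)
  fix S T i assume SE: "S \<subseteq> E" and TE: "T \<subseteq> E" and i: "i \<in> S" "i \<notin> T"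
  note fin = finite_subset[OF _ matroid_finite_ground[OF M]]
  note finS = fin[OF SE] and finT = fin[OF TE]
  obtain I where I: "I \<in> \<I>" "I \<subseteq> S" "?f S = sum w I"
    using max_weight_attained[OF finS matroid_empty[OF M]] .
  obtain J where J: "J \<in> \<I>" "J \<subseteq> T" "?f T = sum w J"
    using max_weight_attained[OF finT matroid_empty[OF M]] .
  note finI = matroid_finite[OF M I(1)] and finJ = matroid_finite[OF M J(1)]
  have attained: "?f S + ?f T \<le> ?f S' + ?f T'"
    if "sum w I' + sum w J' = sum w I + sum w J" "I' \<in> \<I>" "J' \<in> \<I>" "I' \<subseteq> S'" "J' \<subseteq> T'"
      "finite S'" "finite T'" for S' T' I' J'
    using max_weight_ge[of S' I' \<I> w] max_weight_ge[of T' J' \<I> w] that I(3) J(3) by simp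
  have iJ: "i \<notin> J" using J(2) i(2) by blast
  consider (unused) "i \<notin> I" | (independent) "i \<in> I" "insert i J \<in> \<I>"
    | (dependent) "i \<in> I" "insert i J \<notin> \<I>" by blast
  then show "?f S + ?f T \<le> ?f (S - {i}) + ?f (insert i T) \<or>
     (\<exists>j\<in>T - S. ?f S + ?f T \<le> ?f (insert j (S - {i})) + ?f (insert i (T - {j})))"
  proof cases
    case unused
    then show ?thesis using I J finS finT by (intro disjI1 attained[of I J]) auto
  next
    case independent
    then show ?thesis using I J iJ finI finJ finS finT matroid_hereditary[OF M I(1)]
      by (intro disjI1 attained[of "I - {i}" "insert i J"]) (auto simp: sum_diff1)
  next
    case dependent
    obtain j where j: "j \<in> J" "j \<notin> I" "insert j (I - {i}) \<in> \<I>" "insert i (J - {j}) \<in> \<I>"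
      using matroid_symmetric_exchange[OF M I(1) J(1) dependent(1) iJ dependent(2)] .
    have eq: "sum w (insert j (I - {i})) + sum w (insert i (J - {j})) = sum w I + sum w J"
      using j(1,2) dependent(1) iJ finI finJ by (simp add: sum_diff1)
    note attained = attained[OF eq j(3,4)]
    show ?thesis
    proof (cases "j \<in> S")
      case True
      have "j \<noteq> i" using j(1) iJ by blast
      then show ?thesis using I J True finS finT by (intro disjI1 attained) auto
    next
      case False
      then show ?thesis using I J j(1) finS finT by (intro disjI2 bexI[of _ j] attained) auto
    qed
  qed
qed

section \<open>Operations that preserve gross substitutes\<close>

subsection \<open>Endowment and restriction\<close>

definition minor_prices :: "real \<Rightarrow> 'a set \<Rightarrow> 'a set \<Rightarrow> ('a \<Rightarrow> real) \<Rightarrow> 'a \<Rightarrow> real" where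
  "minor_prices M T F p i = (if i \<in> T then - M else if i \<in> F then p i else M)"

lemma sum_minor_prices:
  assumes "finite T" "finite S" "S \<subseteq> F - T"
  shows "sum (minor_prices M T F p) (S \<union> T) = sum p S - real (card T) * M"
proof -
  have "sum (minor_prices M T F p) S = sum p S"
    using assms(3) by (intro sum.cong) (auto simp: minor_prices_def)
  moreover have "sum (minor_prices M T F p) T = - (real (card T) * M)"
    by (simp add: minor_prices_def)
  moreover have "S \<inter> T = {}" using assms(3) by blast
  ultimately show ?thesis using assms(1,2) by (simp add: sum.union_disjoint)
qed

lemma minor_prices_improve:
  assumes fin: "finite E" and sub: "T \<subseteq> F" "F \<subseteq> E" and A: "A \<subseteq> E"
    and bound: "\<forall>A\<subseteq>E. \<forall>B\<subseteq>E. u A - u B < M"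
    and out: "\<not> (T \<subseteq> A \<and> A \<subseteq> F)"
  shows "u A - sum (minor_prices M T F p) A
    < u (A \<inter> F \<union> T) - sum (minor_prices M T F p) (A \<inter> F \<union> T)"
proof -
  let ?s = "sum (minor_prices M T F p)"
  have finA: "finite A" and finT: "finite T"
    using A sub fin by (meson finite_subset subset_trans)+
  have "?s A = ?s (A \<inter> F) + ?s (A - F)" using finA by (rule sum.Int_Diff)
  moreover have "?s (A - F) = (\<Sum>i\<in>A - F. M)"
    using sub(1) by (intro sum.cong) (auto simp: minor_prices_def)
  moreover have "A \<inter> F \<union> T = (A \<inter> F) \<union> (T - A)" using sub(1) by blast
  then have "?s (A \<inter> F \<union> T) = ?s (A \<inter> F) + ?s (T - A)"
    using finA finT by (auto intro!: sum.union_disjoint)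
  moreover have "?s (T - A) = (\<Sum>i\<in>T - A. - M)"
    by (intro sum.cong) (auto simp: minor_prices_def)
  ultimately have gap: "?s A - ?s (A \<inter> F \<union> T) = real (card (A - F) + card (T - A)) * M"
    by (simp add: algebra_simps)
  have "card (A - F) + card (T - A) \<noteq> 0" using out finA finT by auto
  moreover have "0 < M" using bound[rule_format, of "{}" "{}"] by simp
  ultimately have "M \<le> real (card (A - F) + card (T - A)) * M"
    by (intro mult_le_cancel_right1[THEN iffD2]) auto
  moreover have "u A - u (A \<inter> F \<union> T) < M"
    using A sub by (intro bound[rule_format]) auto
  ultimately show ?thesis using gap by linarith
qed

lemma demanded_minor_prices_iff:
  assumes fin: "finite E" and sub: "T \<subseteq> F" "F \<subseteq> E"
    and bound: "\<forall>A\<subseteq>E. \<forall>B\<subseteq>E. u A - u B < M"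
  shows "A \<in> demanded E u (minor_prices M T F p) \<longleftrightarrow>
    T \<subseteq> A \<and> A \<subseteq> F \<and> A - T \<in> demanded (F - T) (\<lambda>S. u (S \<union> T) - u T) p"
    (is "?L \<longleftrightarrow> ?R")
proof
  let ?util = "\<lambda>A. u A - sum (minor_prices M T F p) A"
  have util: "?util (S \<union> T) = u (S \<union> T) - sum p S + real (card T) * M" if "S \<subseteq> F - T" for S
    using sum_minor_prices[OF _ _ that] that fin sub by (simp add: finite_subset)
  note improve = minor_prices_improve[OF fin sub _ bound]
  {
    assume L: ?L
    have TAF: "T \<subseteq> A" "A \<subseteq> F"
      using improve[OF demanded_subset[OF L], of p] demanded_maximal[OF L, of "A \<inter> F \<union> T"] sub
      by (auto simp flip: not_less)
    moreover have "A - T \<in> demanded (F - T) (\<lambda>S. u (S \<union> T) - u T) p"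
    proof (rule demandedI)
      fix S assume S: "S \<subseteq> F - T"
      have "?util (S \<union> T) \<le> ?util (A - T \<union> T)"
        using demanded_maximal[OF L, of "S \<union> T"] S sub TAF by (auto simp: Un_absorb2)
      moreover have "A - T \<subseteq> F - T" using TAF by blast
      ultimately show "u (S \<union> T) - u T - sum p S \<le> u (A - T \<union> T) - u T - sum p (A - T)"
        using util[OF S] util[of "A - T"] by linarith
    qed (use TAF in blast)
    ultimately show ?R by blast
  next
    assume R: ?R
    show ?L
    proof (rule demandedI)
      fix B assume B: "B \<subseteq> E"
      have "?util B \<le> ?util (B \<inter> F \<union> T)"
        using improve[OF B, of p]
        by (cases "T \<subseteq> B \<and> B \<subseteq> F") (auto simp only: Un_absorb2 Int_absorb2 intro: less_imp_le)
      also have "B \<inter> F \<union> T = (B \<inter> F - T) \<union> T" by blast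
      also have "?util ((B \<inter> F - T) \<union> T) \<le> ?util ((A - T) \<union> T)"
        using demanded_maximal[of "A - T" "F - T" _ p "B \<inter> F - T"] R
          util[of "B \<inter> F - T"] util[of "A - T"] by fastforce
      also have "(A - T) \<union> T = A" using R by blast
      finally show "?util B \<le> ?util A" .
    qed (use R sub in blast)
  }
qed

lemma substitutes_minor:
  assumes fin: "finite E" and sb: "substitutes E u" and sub: "T \<subseteq> F" "F \<subseteq> E"
  shows "substitutes (F - T) (\<lambda>S. u (S \<union> T) - u T)"
proof (rule substitutesI)
  let ?minor = "\<lambda>S. u (S \<union> T) - u T"
  fix p q :: "'a \<Rightarrow> real" and S
  assume pq: "\<And>i. i \<in> F - T \<Longrightarrow> p i \<le> q i" and S: "S \<in> demanded (F - T) ?minor p"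
  define C where "C = (\<Sum>A\<in>Pow E. \<bar>u A\<bar>)"
  have "\<bar>u A\<bar> \<le> C" if "A \<subseteq> E" for A
    unfolding C_def using that fin by (intro member_le_sum) auto
  then have bound: "\<forall>A\<subseteq>E. \<forall>B\<subseteq>E. u A - u B < 2 * C + 1" by (smt (verit))
  let ?prices = "minor_prices (2 * C + 1) T F"
  note iff = demanded_minor_prices_iff[OF fin sub bound]
  have SF: "S \<subseteq> F - T" using demanded_subset[OF S] .
  then have ST: "S \<union> T - T = S" by blast
  have "S \<union> T \<in> demanded E u (?prices p)"
    unfolding iff ST using S SF sub by blast
  then obtain B where B: "B \<in> demanded E u (?prices q)"
    "{i \<in> S \<union> T. ?prices p i = ?prices q i} \<subseteq> B"
    by (rule substitutesE[OF sb, of _ _ "?prices q"]) (use pq in \<open>auto simp: minor_prices_def\<close>)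
  have "{i\<in>S. p i = q i} \<subseteq> B - T" using B(2) SF by (auto simp: minor_prices_def)
  then show "\<exists>B\<in>demanded (F - T) ?minor q. {i\<in>S. p i = q i} \<subseteq> B" using B(1) iff by blast
qed

text \<open>If the two items were complements, then at the prices \<^term>\<open>p\<close> below the pair, the first item
  and nothing would be equally good and the second item alone would be worse, so the second item
  would not stay demanded when the price of the first rises.\<close>

lemma substitutes_pair:
  assumes sb: "substitutes {i, j} u" and ij: "i \<noteq> j"
  shows "u {i, j} + u {} \<le> u {i} + u {j}"
proof (rule ccontr)
  assume super: "\<not> ?thesis"
  define p where "p = (\<lambda>_. u {i, j} - u {i})(i := u {i} - u {})"
  have cases: "S \<in> {{}, {i}, {j}, {i, j}}" if "S \<subseteq> {i, j}" for S using that by blast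
  have p: "p i = u {i} - u {}" "p j = u {i, j} - u {i}" using ij by (simp_all add: p_def)
  have max: "u S - sum p S \<le> u {}" if "S \<subseteq> {i, j}" for S
    using cases[OF that] super ij by (auto simp: p)
  have "{i, j} \<in> demanded {i, j} u p" "{} \<in> demanded {i, j} u p"
    using max ij by (auto intro!: demandedI simp: p)
  then obtain T where T: "T \<in> demanded {i, j} u p" "{i, j} - {i} \<subseteq> T" "i \<notin> T"
    using substitutes_drop_item[OF _ sb, of "{i, j}" p "{}" i] by auto
  have "T = {j}" using demanded_subset[OF T(1)] T(2,3) ij by blast
  then show False using demanded_maximal[OF T(1), of "{}"] super by (simp add: p)
qed

lemma substitutes_submodular:
  assumes fin: "finite E" and sb: "substitutes E u"
    and sub: "insert i (insert j S) \<subseteq> E" and ij: "i \<notin> S" "j \<notin> S" "i \<noteq> j"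
  shows "u (insert i (insert j S)) + u S \<le> u (insert i S) + u (insert j S)"
proof -
  have "insert i (insert j S) - S = {i, j}" using ij by blast
  then have "substitutes {i, j} (\<lambda>X. u (X \<union> S) - u S)"
    using substitutes_minor[OF fin sb _ sub, of S] by auto
  from substitutes_pair[OF this ij(3)] show ?thesis by simp
qed

lemma substitutes_marginal_le_singleton:
  assumes fin: "finite E" and sb: "substitutes E u" and u0: "u {} = 0"
    and S: "insert i S \<subseteq> E" "i \<notin> S"
  shows "u (insert i S) \<le> u S + u {i}"
proof -
  have "finite S" using finite_subset[of S E] S(1) fin by simp
  then show ?thesis using S
  proof (induction S rule: finite_induct)
    case empty
    then show ?case by (simp add: u0)
  next
    case (insert j S)
    then have "u (insert i (insert j S)) + u S \<le> u (insert i S) + u (insert j S)"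
      by (intro substitutes_submodular[OF fin sb]) auto
    moreover have "u (insert i S) \<le> u S + u {i}" using insert.IH insert.prems by blast
    ultimately show ?case by linarith
  qed
qed

lemma substitutes_le_sum_singletons:
  assumes fin: "finite E" and sb: "substitutes E u" and u0: "u {} = 0" and S: "S \<subseteq> E"
  shows "u S \<le> (\<Sum>i\<in>S. u {i})"
  using finite_subset[OF S fin] S
proof (induction S rule: finite_induct)
  case empty
  then show ?case by (simp add: u0)
next
  case (insert i S)
  then show ?case using substitutes_marginal_le_singleton[OF fin sb u0, of i S] by simp
qed

subsection \<open>Renaming and direct sums\<close>

lemma substitutes_rename:
  assumes inj: "inj_on f E" and sb: "substitutes (f ` E) u"
  shows "substitutes E (\<lambda>S. u (f ` S))"
proof (rule substitutesI)
  let ?g = "inv_into E f"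
  fix p q :: "'a \<Rightarrow> real" and S
  assume pq: "\<And>i. i \<in> E \<Longrightarrow> p i \<le> q i" and S: "S \<in> demanded E (\<lambda>S. u (f ` S)) p"
  have sum_f: "(\<Sum>i\<in>f ` T. r (?g i)) = sum r T" if "T \<subseteq> E" for r :: "'a \<Rightarrow> real" and T
    using that inj by (simp add: sum.reindex inj_on_subset subset_iff)
  have demanded_f: "f ` T \<in> demanded (f ` E) u (\<lambda>i. r (?g i)) \<longleftrightarrow> T \<in> demanded E (\<lambda>S. u (f ` S)) r"
    if "T \<subseteq> E" for r T
    using that by (auto simp: demanded_def all_subset_image sum_f)
  have SE: "S \<subseteq> E" using demanded_subset[OF S] .
  obtain T where T: "T \<in> demanded (f ` E) u (\<lambda>i. q (?g i))"
    "{i \<in> f ` S. p (?g i) = q (?g i)} \<subseteq> T"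
    by (rule substitutesE[OF sb, of "f ` S" "\<lambda>i. p (?g i)" "\<lambda>i. q (?g i)"])
      (use S SE pq inj in \<open>auto simp: demanded_f\<close>)
  obtain T' where T': "T' \<subseteq> E" "T = f ` T'"
    using demanded_subset[OF T(1)] by (auto simp: subset_image_iff)
  have "i \<in> T'" if "i \<in> S" "p i = q i" for i
  proof -
    have iE: "i \<in> E" using that(1) SE by blast
    then have "f i \<in> f ` T'" using that T(2) inv_into_f_f[OF inj iE] by (auto simp: T'(2))
    then show ?thesis using inj_on_image_mem_iff[OF inj iE T'(1)] by blast
  qed
  moreover have "T' \<in> demanded E (\<lambda>S. u (f ` S)) q" using T(1) T' demanded_f by simp
  ultimately show "\<exists>T\<in>demanded E (\<lambda>S. u (f ` S)) q. {i\<in>S. p i = q i} \<subseteq> T" by blast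
qed

definition direct_sum :: "('a set \<Rightarrow> real) \<Rightarrow> ('b set \<Rightarrow> real) \<Rightarrow> ('a + 'b) set \<Rightarrow> real" where
  "direct_sum u v S = u (Inl -` S) + v (Inr -` S)"

lemma direct_sum_Plus: "direct_sum u v (X <+> Y) = u X + v Y"
proof -
  have "Inl -` (X <+> Y) = X" "Inr -` (X <+> Y) = Y" by auto
  then show ?thesis by (simp add: direct_sum_def)
qed

lemma subset_Plus_iff: "S \<subseteq> A <+> B \<longleftrightarrow> (\<exists>X\<subseteq>A. \<exists>Y\<subseteq>B. S = X <+> Y)"
proof
  assume S: "S \<subseteq> A <+> B"
  then have "S = Inl -` S <+> Inr -` S" by (auto simp: Plus_def)
  moreover have "Inl -` S \<subseteq> A" "Inr -` S \<subseteq> B" using S by auto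
  ultimately show "\<exists>X\<subseteq>A. \<exists>Y\<subseteq>B. S = X <+> Y" by blast
qed auto

lemma demanded_direct_sum_iff:
  assumes fin: "finite A" "finite B" and X: "X \<subseteq> A" and Y: "Y \<subseteq> B"
  shows "X <+> Y \<in> demanded (A <+> B) (direct_sum u v) p \<longleftrightarrow>
    X \<in> demanded A u (p \<circ> Inl) \<and> Y \<in> demanded B v (p \<circ> Inr)" (is "?L \<longleftrightarrow> ?R")
proof
  have util: "direct_sum u v (X <+> Y) - sum p (X <+> Y) =
      (u X - sum (p \<circ> Inl) X) + (v Y - sum (p \<circ> Inr) Y)" if "X \<subseteq> A" "Y \<subseteq> B" for X Y
    using that fin by (simp add: direct_sum_Plus sum.Plus finite_subset)
  have sub: "X' <+> Y' \<subseteq> A <+> B" if "X' \<subseteq> A" "Y' \<subseteq> B" for X' Y' using that by auto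
  {
    assume L: ?L
    show ?R
    proof (intro conjI demandedI)
      show "u X' - sum (p \<circ> Inl) X' \<le> u X - sum (p \<circ> Inl) X" if "X' \<subseteq> A" for X'
        using demanded_maximal[OF L sub[OF that Y]] util[OF that Y] util[OF X Y] by simp
      show "v Y' - sum (p \<circ> Inr) Y' \<le> v Y - sum (p \<circ> Inr) Y" if "Y' \<subseteq> B" for Y'
        using demanded_maximal[OF L sub[OF X that]] util[OF X that] util[OF X Y] by simp
    qed fact+
  next
    assume R: ?R
    show ?L
    proof (rule demandedI[OF sub[OF X Y]])
      fix S assume "S \<subseteq> A <+> B"
      then obtain X' Y' where S: "X' \<subseteq> A" "Y' \<subseteq> B" "S = X' <+> Y'" by (auto simp: subset_Plus_iff)
      show "direct_sum u v S - sum p S \<le> direct_sum u v (X <+> Y) - sum p (X <+> Y)"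
        unfolding S(3) util[OF S(1,2)] util[OF X Y] using R S(1,2)
        by (intro add_mono demanded_maximal) blast+
    qed
  }
qed

lemma substitutes_direct_sum:
  assumes fin: "finite A" "finite B" and sb: "substitutes A u" "substitutes B v"
  shows "substitutes (A <+> B) (direct_sum u v)"
proof (rule substitutesI)
  fix p q :: "'a + 'b \<Rightarrow> real" and S
  assume pq: "\<And>i. i \<in> A <+> B \<Longrightarrow> p i \<le> q i" and S: "S \<in> demanded (A <+> B) (direct_sum u v) p"
  obtain X Y where XY: "X \<subseteq> A" "Y \<subseteq> B" "S = X <+> Y"
    using demanded_subset[OF S] by (auto simp: subset_Plus_iff)
  have dem: "X \<in> demanded A u (p \<circ> Inl)" "Y \<in> demanded B v (p \<circ> Inr)"
    using S demanded_direct_sum_iff[OF fin XY(1,2)] XY(3) by blast+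
  obtain X' where X': "X' \<in> demanded A u (q \<circ> Inl)" "{i\<in>X. (p \<circ> Inl) i = (q \<circ> Inl) i} \<subseteq> X'"
    by (rule substitutesE[OF sb(1) dem(1), of "q \<circ> Inl"]) (use pq in auto)
  obtain Y' where Y': "Y' \<in> demanded B v (q \<circ> Inr)" "{i\<in>Y. (p \<circ> Inr) i = (q \<circ> Inr) i} \<subseteq> Y'"
    by (rule substitutesE[OF sb(2) dem(2), of "q \<circ> Inr"]) (use pq in auto)
  have "X' <+> Y' \<in> demanded (A <+> B) (direct_sum u v) q"
    using demanded_direct_sum_iff[OF fin demanded_subset[OF X'(1)] demanded_subset[OF Y'(1)]]
      X'(1) Y'(1) by blast
  moreover have "{i\<in>S. p i = q i} \<subseteq> X' <+> Y'" using X'(2) Y'(2) by (auto simp: XY(3))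
  ultimately show "\<exists>T\<in>demanded (A <+> B) (direct_sum u v) q. {i\<in>S. p i = q i} \<subseteq> T" by blast
qed

subsection \<open>Identifying two copies of an item\<close>

lemma first_zero_of_decreasing_affine:
  fixes a b :: "'b \<Rightarrow> real"
  assumes fin: "finite N" and ne: "N \<noteq> {}" and pos: "\<And>i. i \<in> N \<Longrightarrow> 0 < b i"
    and nonneg: "\<And>i. i \<in> N \<Longrightarrow> 0 \<le> a i - b i * t0"
  obtains t k where "t0 \<le> t" "\<forall>i\<in>N. 0 \<le> a i - b i * t" "k \<in> N" "a k - b k * t = 0"
proof -
  define t where "t = Min ((\<lambda>i. a i / b i) ` N)"
  have "t \<in> (\<lambda>i. a i / b i) ` N" unfolding t_def using fin ne by (intro Min_in) auto
  then obtain k where k: "k \<in> N" "t = a k / b k" by blast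
  show thesis
  proof (rule that[OF _ _ k(1)])
    show "t0 \<le> t" using nonneg[OF k(1)] pos[OF k(1)] by (simp add: k(2) field_simps)
    show "\<forall>i\<in>N. 0 \<le> a i - b i * t"
    proof
      fix i assume i: "i \<in> N"
      have "t \<le> a i / b i" unfolding t_def using fin i by simp
      then show "0 \<le> a i - b i * t" using pos[OF i] by (simp add: field_simps)
    qed
    show "a k - b k * t = 0" using pos[OF k(1)] by (simp add: k(2))
  qed
qed

definition identify :: "'a \<Rightarrow> 'a \<Rightarrow> ('a set \<Rightarrow> real) \<Rightarrow> 'a set \<Rightarrow> real" where
  "identify x y w S = (if x \<in> S then max (w S) (w (insert y (S - {x}))) else w S)"

text \<open>Demand for \<^term>\<open>identify x y w\<close> is read off the demand for \<^term>\<open>w\<close> at which both copies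
  have a common price \<open>t\<close>. This price is so high that not both copies need be demanded; it exceeds
  the price asked for \<^term>\<open>x\<close> only if one copy is demanded.\<close>

locale identification =
  fixes E :: "'a set" and w :: "'a set \<Rightarrow> real" and x y :: 'a
  assumes finite_ground: "finite E" and substitutes_w: "substitutes E w"
    and x_in: "x \<in> E" and y_in: "y \<in> E" and x_neq_y: "x \<noteq> y"
begin

definition common_price :: "('a \<Rightarrow> real) \<Rightarrow> real \<Rightarrow> 'a \<Rightarrow> real" where
  "common_price p t = p(x := t, y := t)"

definition both_copies :: "'a set \<Rightarrow> bool" where
  "both_copies T \<longleftrightarrow> x \<in> T \<and> y \<in> T"

definition some_copy :: "'a set \<Rightarrow> bool" where
  "some_copy T \<longleftrightarrow> x \<in> T \<or> y \<in> T"

definition collapse :: "'a set \<Rightarrow> 'a set" where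
  "collapse T = (if y \<in> T then insert x (T - {y}) else T)"

definition equilibrium :: "('a \<Rightarrow> real) \<Rightarrow> real \<Rightarrow> 'a set \<Rightarrow> bool" where
  "equilibrium p t T \<longleftrightarrow> T \<in> demanded E w (common_price p t) \<and> \<not> both_copies T \<and> p x \<le> t \<and>
     (t = p x \<or> some_copy T)"

lemma in_collapse_iff:
  "x \<in> collapse T \<longleftrightarrow> some_copy T" "i \<noteq> x \<Longrightarrow> i \<noteq> y \<Longrightarrow> i \<in> collapse T \<longleftrightarrow> i \<in> T" "y \<notin> collapse T"
  using x_neq_y by (auto simp: collapse_def some_copy_def)

lemma collapse_subset: "T \<subseteq> E \<Longrightarrow> collapse T \<subseteq> E - {y}"
  using x_in x_neq_y by (auto simp: collapse_def)

lemma sum_common_price: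
  assumes "T \<subseteq> E"
  shows "sum (common_price p t) T =
    sum p (T - {x, y}) + (of_bool (x \<in> T) + of_bool (y \<in> T)) * t"
proof -
  have "finite T" using assms finite_ground by (rule finite_subset)
  then have "sum (common_price p t) T =
      sum (common_price p t) (T \<inter> {x, y}) + sum (common_price p t) (T - {x, y})"
    by (rule sum.Int_Diff)
  moreover have "sum (common_price p t) (T - {x, y}) = sum p (T - {x, y})"
    by (intro sum.cong) (auto simp: common_price_def)
  moreover have "sum (common_price p t) (T \<inter> {x, y}) = (of_bool (x \<in> T) + of_bool (y \<in> T)) * t"
    using x_neq_y by (auto simp: common_price_def Int_insert_right)
  ultimately show ?thesis by simp
qed

lemma sum_common_price_collapse:
  assumes "T \<subseteq> E" "\<not> both_copies T"
  shows "sum (common_price p t) T = sum p (collapse T) + (if some_copy T then t - p x else 0)"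
proof -
  have "finite (collapse T)"
    using collapse_subset[OF assms(1)] finite_ground by (meson finite_Diff finite_subset)
  moreover have "collapse T - {x} = T - {x, y}" by (auto simp: collapse_def)
  ultimately have "sum p (collapse T) = sum p (T - {x, y}) + (if some_copy T then p x else 0)"
    using sum_diff1[of "collapse T" p x] by (simp add: in_collapse_iff)
  then show ?thesis
    using sum_common_price[OF assms(1)] assms(2) by (auto simp: both_copies_def some_copy_def)
qed

lemma identify_collapse_ge:
  assumes "\<not> both_copies T"
  shows "w T \<le> identify x y w (collapse T)"
proof (cases "y \<in> T")
  case True
  then have "insert y (insert x (T - {y}) - {x}) = T"
    using assms x_neq_y by (auto simp: both_copies_def)
  then show ?thesis using True by (simp add: identify_def collapse_def)
qed (simp add: identify_def collapse_def)

lemma identify_attained: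
  assumes "S \<subseteq> E - {y}"
  obtains T where "T \<subseteq> E" "\<not> both_copies T" "collapse T = S" "identify x y w S = w T"
proof (cases "x \<in> S \<and> w S < w (insert y (S - {x}))")
  case True
  then show thesis using assms y_in x_neq_y
    by (intro that[of "insert y (S - {x})"])
      (auto simp: identify_def both_copies_def collapse_def)
next
  case False
  then show thesis using assms
    by (intro that[of S]) (auto simp: identify_def both_copies_def collapse_def)
qed

lemma equilibrium_imp_demanded:
  assumes "equilibrium p t T"
  shows "collapse T \<in> demanded (E - {y}) (identify x y w) p"
proof (rule demandedI)
  have T: "T \<in> demanded E w (common_price p t)" "\<not> both_copies T" "p x \<le> t" "t = p x \<or> some_copy T"
    using assms by (auto simp: equilibrium_def)
  note TE = demanded_subset[OF T(1)]
  show "collapse T \<subseteq> E - {y}" using collapse_subset[OF TE] .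
  fix S assume "S \<subseteq> E - {y}"
  then obtain T' where T': "T' \<subseteq> E" "\<not> both_copies T'" "collapse T' = S"
    "identify x y w S = w T'" by (rule identify_attained)
  have "w T' - sum (common_price p t) T' \<le> w T - sum (common_price p t) T"
    using demanded_maximal[OF T(1) T'(1)] .
  then show "identify x y w S - sum p S \<le> identify x y w (collapse T) - sum p (collapse T)"
    using sum_common_price_collapse[OF T'(1,2), of p t]
      sum_common_price_collapse[OF TE T(2), of p t] T'(3,4) T(3,4) identify_collapse_ge[OF T(2)] by (auto split: if_splits)
qed

lemma demanded_imp_equilibrium:
  assumes eq: "equilibrium p t T0" and S: "S \<in> demanded (E - {y}) (identify x y w) p"
  obtains T where "equilibrium p t T" "collapse T = S"
proof -
  have T0: "T0 \<in> demanded E w (common_price p t)" "\<not> both_copies T0" "p x \<le> t"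
    "t = p x \<or> some_copy T0"
    using eq by (auto simp: equilibrium_def)
  obtain T where T: "T \<subseteq> E" "\<not> both_copies T" "collapse T = S" "identify x y w S = w T"
    using demanded_subset[OF S] by (rule identify_attained)
  have "identify x y w (collapse T0) - sum p (collapse T0) \<le> identify x y w S - sum p S"
    using demanded_maximal[OF S] demanded_subset[OF equilibrium_imp_demanded[OF eq]] by blast
  then have ge: "w T0 - sum (common_price p t) T0 + (if some_copy T then 0 else t - p x)
      \<le> w T - sum (common_price p t) T"
    using sum_common_price_collapse[OF T(1,2), of p t] T(3,4) identify_collapse_ge[OF T0(2)] T0(4)
      sum_common_price_collapse[OF demanded_subset[OF T0(1)] T0(2), of p t]
    by (auto split: if_splits)
  have "T \<in> demanded E w (common_price p t)"
    by (rule demanded_if_ge[OF T0(1) T(1)]) (use ge T0(3) in \<open>auto split: if_splits\<close>)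
  moreover have "t = p x \<or> some_copy T"
    using ge demanded_maximal[OF T0(1) T(1)] T0(3) by (auto split: if_splits)
  ultimately have "equilibrium p t T" using T(2) T0(3) by (simp add: equilibrium_def)
  then show thesis using that T(3) by blast
qed

lemma raise_to_tie:
  assumes T: "T \<in> demanded E w (common_price p t0)" "both_copies T"
  obtains t U where "t0 \<le> t" "T \<in> demanded E w (common_price p t)"
    "U \<in> demanded E w (common_price p t)" "\<not> both_copies U"
proof -
  define N where "N = {U. U \<subseteq> E \<and> \<not> both_copies U}"
  define copies :: "'a set \<Rightarrow> real" where "copies U = of_bool (x \<in> U) + of_bool (y \<in> U)" for U
  define a where "a U = (w T - sum p (T - {x, y})) - (w U - sum p (U - {x, y}))" for U
  define b where "b U = 2 - copies U" for U
  have TE: "T \<subseteq> E" using demanded_subset[OF T(1)] .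
  have copies_T: "copies T = 2" using T(2) by (simp add: copies_def both_copies_def)
  have gap: "(w T - sum (common_price p t) T) - (w U - sum (common_price p t) U) = a U - b U * t"
    if "U \<subseteq> E" for U t
    using sum_common_price[OF that, of p t] sum_common_price[OF TE, of p t] copies_T
    unfolding copies_def[symmetric] by (simp add: a_def b_def algebra_simps)
  have gap0: "0 \<le> a U - b U * t0" if "U \<subseteq> E" for U
    using gap[OF that, of t0] demanded_maximal[OF T(1) that] by simp
  have "finite N" using finite_ground by (simp add: N_def)
  moreover have "{} \<in> N" by (simp add: N_def both_copies_def)
  then have "N \<noteq> {}" by blast
  moreover have "0 < b U" if "U \<in> N" for U
    using that by (auto simp: N_def b_def copies_def both_copies_def)
  moreover have "0 \<le> a U - b U * t0" if "U \<in> N" for U using gap0 that by (simp add: N_def)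
  ultimately obtain t U where t: "t0 \<le> t" "\<forall>V\<in>N. 0 \<le> a V - b V * t"
    and U: "U \<in> N" "a U - b U * t = 0" by (rule first_zero_of_decreasing_affine)
  have T_t: "T \<in> demanded E w (common_price p t)"
  proof (rule demandedI[OF TE])
    fix V assume V: "V \<subseteq> E"
    have "0 \<le> a V - b V * t"
    proof (cases "both_copies V")
      case True
      then have "b V = 0" by (simp add: b_def copies_def both_copies_def)
      then show ?thesis using gap0[OF V] by simp
    qed (use V t(2) in \<open>simp add: N_def\<close>)
    then show "w V - sum (common_price p t) V \<le> w T - sum (common_price p t) T"
      using gap[OF V, of t] by simp
  qed
  have "U \<in> demanded E w (common_price p t)"
    by (rule demanded_if_ge[OF T_t]) (use U gap[of U t] in \<open>simp_all add: N_def\<close>)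
  then show thesis using that t(1) T_t U(1) by (simp add: N_def)
qed

lemma raise_to_equilibrium:
  assumes T: "T \<in> demanded E w (common_price p t0)" and t0: "p x \<le> t0" "t0 = p x \<or> some_copy T"
  obtains t T' where "equilibrium p t T'" "T - {x, y} \<subseteq> T'" "some_copy T \<longrightarrow> some_copy T'"
proof (cases "both_copies T")
  case False
  then have "equilibrium p t0 T" using T t0 by (simp add: equilibrium_def)
  then show thesis by (rule that) auto
next
  case True
  from T True obtain t U where t: "t0 \<le> t" "T \<in> demanded E w (common_price p t)"
    and U: "U \<in> demanded E w (common_price p t)" "\<not> both_copies U"
    by (rule raise_to_tie)
  obtain z where z: "z \<in> {x, y}" "z \<notin> U" using U(2) by (auto simp: both_copies_def)
  obtain T' where T': "T' \<in> demanded E w (common_price p t)" "T - {z} \<subseteq> T'" "z \<notin> T'"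
    by (rule substitutes_drop_item[OF finite_ground substitutes_w t(2) U(1) z(2)])
  have "some_copy T'" using True T'(2) z(1) x_neq_y by (auto simp: both_copies_def some_copy_def)
  moreover from this have "equilibrium p t T'"
    using T'(1,3) z(1) t(1) t0(1) by (auto simp: equilibrium_def both_copies_def)
  ultimately show thesis using that T'(2) z(1) by blast
qed

lemma equilibrium_exists:
  obtains t T where "equilibrium p t T"
proof -
  obtain T where "T \<in> demanded E w (common_price p (p x))"
    using demanded_nonempty[OF finite_ground] .
  then show thesis by (rule raise_to_equilibrium) (use that in auto)
qed

lemma equilibrium_at_higher_prices:
  assumes eq: "equilibrium p t S" and pq: "\<And>i. i \<in> E - {y} \<Longrightarrow> p i \<le> q i"
  obtains t' T where "equilibrium q t' T" "{i \<in> S - {x, y}. p i = q i} \<subseteq> T"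
    "p x = q x \<longrightarrow> some_copy S \<longrightarrow> some_copy T"
proof -
  have S: "S \<in> demanded E w (common_price p t)" "p x \<le> t" "t = p x \<or> some_copy S"
    using eq by (auto simp: equilibrium_def)
  define t0 where "t0 = max t (q x)"
  have pqx: "p x \<le> q x" using pq x_in x_neq_y by blast
  obtain T0 where T0: "T0 \<in> demanded E w (common_price q t0)"
    "{i\<in>S. common_price p t i = common_price q t0 i} \<subseteq> T0"
    by (rule substitutesE[OF substitutes_w S(1), of "common_price q t0"])
      (use pq in \<open>auto simp: common_price_def t0_def\<close>)
  have some: "some_copy T0" if "some_copy S" "t0 = t"
    using that T0(2) by (auto simp: common_price_def some_copy_def)
  have "q x \<le> t0" "t0 = q x \<or> some_copy T0"
    using some S(2,3) pqx by (auto simp: t0_def max_def split: if_splits)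
  then obtain t' T where T: "equilibrium q t' T" "T0 - {x, y} \<subseteq> T"
    "some_copy T0 \<longrightarrow> some_copy T"
    using raise_to_equilibrium[OF T0(1)] by blast
  have "{i \<in> S - {x, y}. p i = q i} \<subseteq> T" using T0(2) T(2) by (auto simp: common_price_def)
  moreover have "some_copy T" if "p x = q x" "some_copy S"
  proof -
    have "t0 = t" using that(1) S(2) by (simp add: t0_def)
    then show ?thesis using some T(3) that(2) by blast
  qed
  ultimately show thesis using that T(1) by blast
qed

lemma substitutes_identify: "substitutes (E - {y}) (identify x y w)"
proof (rule substitutesI)
  fix p q :: "'a \<Rightarrow> real" and S
  assume pq: "\<And>i. i \<in> E - {y} \<Longrightarrow> p i \<le> q i"
    and S: "S \<in> demanded (E - {y}) (identify x y w) p"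
  obtain t T0 where "equilibrium p t T0" by (rule equilibrium_exists)
  then obtain S' where S': "equilibrium p t S'" "collapse S' = S"
    using S by (rule demanded_imp_equilibrium)
  obtain t' T where T: "equilibrium q t' T" "{i \<in> S' - {x, y}. p i = q i} \<subseteq> T"
    "p x = q x \<longrightarrow> some_copy S' \<longrightarrow> some_copy T"
    using S'(1) pq by (rule equilibrium_at_higher_prices)
  have "i \<in> collapse T" if "i \<in> S" "p i = q i" for i
  proof (cases "i = x")
    case True
    then show ?thesis using that T(3) S'(2) by (auto simp: in_collapse_iff)
  next
    case False
    moreover have "i \<noteq> y" using that(1) S'(2) in_collapse_iff(3) by blast
    ultimately show ?thesis using that T(2) S'(2) by (auto simp: in_collapse_iff)
  qed
  then show "\<exists>T\<in>demanded (E - {y}) (identify x y w) q. {i\<in>S. p i = q i} \<subseteq> T"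
    using equilibrium_imp_demanded[OF T(1)] by blast
qed

end

subsection \<open>Merging\<close>

text \<open>The items of \<^term>\<open>K\<close> occur only as \<^const>\<open>Inl\<close> copies, which either factor may use.\<close>

definition partial_merge ::
  "('a set \<Rightarrow> real) \<Rightarrow> ('a set \<Rightarrow> real) \<Rightarrow> 'a set \<Rightarrow> ('a + 'a) set \<Rightarrow> real" where
  "partial_merge u v K S = Max ((\<lambda>M. u (Inl -` S - M) + v (Inr -` S \<union> M)) ` Pow (K \<inter> Inl -` S))"

lemma partial_merge_empty: "partial_merge u v {} = direct_sum u v"
  by (simp add: partial_merge_def direct_sum_def fun_eq_iff)

lemma partial_merge_insert:
  assumes fin: "finite K" and x: "x \<notin> K"
  shows "partial_merge u v (insert x K) S = identify (Inl x) (Inr x) (partial_merge u v K) S"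
proof (cases "Inl x \<in> S")
  case False
  then have "insert x K \<inter> Inl -` S = K \<inter> Inl -` S" by auto
  then show ?thesis using False by (simp add: identify_def partial_merge_def)
next
  case True
  define L where "L = K \<inter> Inl -` S"
  define S' where "S' = insert (Inr x) (S - {Inl x})"
  let ?val = "\<lambda>M. u (Inl -` S - M) + v (Inr -` S \<union> M)"
  have vimage: "Inl -` S' = Inl -` S - {x}" "Inr -` S' = insert x (Inr -` S)" by (auto simp: S'_def)
  have KL: "K \<inter> (Inl -` S - {x}) = L" using x by (auto simp: L_def)
  have "Inl -` S - {x} - M = Inl -` S - insert x M" for M by blast
  then have moved: "partial_merge u v K S' = Max (?val ` insert x ` Pow L)"
    unfolding partial_merge_def vimage KL image_image by simp
  have "insert x K \<inter> Inl -` S = insert x L" using True by (auto simp: L_def)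
  then have "partial_merge u v (insert x K) S = Max (?val ` Pow L \<union> ?val ` insert x ` Pow L)"
    by (simp add: partial_merge_def Pow_insert image_Un)
  also have "\<dots> = max (Max (?val ` Pow L)) (Max (?val ` insert x ` Pow L))"
    using fin by (intro Max_Un) (auto simp: L_def)
  also have "\<dots> = max (partial_merge u v K S) (partial_merge u v K S')"
    using moved by (simp add: partial_merge_def L_def)
  finally show ?thesis using True by (simp add: identify_def S'_def)
qed

lemma substitutes_partial_merge:
  assumes fin: "finite A" "finite B" and sb: "substitutes A u" "substitutes B v"
    and K: "K \<subseteq> A \<inter> B"
  shows "substitutes (A <+> (B - K)) (partial_merge u v K)"
proof -
  have "finite K" using K fin finite_subset by blast
  then show ?thesis using K
  proof (induction K rule: finite_induct)
    case empty
    show ?case using substitutes_direct_sum[OF fin sb] by (simp add: partial_merge_empty)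
  next
    case (insert x K)
    interpret identification "A <+> (B - K)" "partial_merge u v K" "Inl x" "Inr x"
      using insert fin by unfold_locales auto
    have "A <+> (B - insert x K) = (A <+> (B - K)) - {Inr x}" by auto
    moreover have "partial_merge u v (insert x K) = identify (Inl x) (Inr x) (partial_merge u v K)"
      using partial_merge_insert[OF insert.hyps] by (simp add: fun_eq_iff)
    ultimately show ?case using substitutes_identify by simp
  qed
qed

definition merge_value ::
  "'a set \<Rightarrow> ('a set \<Rightarrow> real) \<Rightarrow> 'a set \<Rightarrow> ('a set \<Rightarrow> real) \<Rightarrow> 'a set \<Rightarrow> real" where
  "merge_value A u B v S = Max {u T + v (S - T) | T. T \<subseteq> S \<inter> A \<and> S - T \<subseteq> B}"

lemma merge_value_eq_partial_merge:
  assumes S: "S \<subseteq> A \<union> B" and f: "\<And>i. f i = (if i \<in> A then Inl i else Inr i)"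
  shows "merge_value A u B v S = partial_merge u v (A \<inter> B) (f ` S)"
proof -
  have vimage: "Inl -` f ` S = S \<inter> A" "Inr -` f ` S = S - A" by (auto simp: f split: if_splits)
  have "{u T + v (S - T) | T. T \<subseteq> S \<inter> A \<and> S - T \<subseteq> B} =
      (\<lambda>M. u (S \<inter> A - M) + v (S - A \<union> M)) ` Pow (A \<inter> B \<inter> (S \<inter> A))" (is "?L = ?R")
  proof
    show "?L \<subseteq> ?R"
    proof
      fix z assume "z \<in> ?L"
      then obtain T where T: "T \<subseteq> S \<inter> A" "S - T \<subseteq> B" "z = u T + v (S - T)" by blast
      then have "S \<inter> A - (S \<inter> A - T) = T" "S - A \<union> (S \<inter> A - T) = S - T" by auto
      then show "z \<in> ?R" using T by (intro image_eqI[of _ _ "S \<inter> A - T"]) auto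
    qed
    show "?R \<subseteq> ?L"
    proof
      fix z assume "z \<in> ?R"
      then obtain M where M: "M \<subseteq> A \<inter> B \<inter> (S \<inter> A)" "z = u (S \<inter> A - M) + v (S - A \<union> M)" by blast
      then have "S - A \<union> M = S - (S \<inter> A - M)" by blast
      then show "z \<in> ?L" using M S by auto
    qed
  qed
  then show ?thesis by (simp add: merge_value_def partial_merge_def vimage)
qed

lemma substitutes_merge_value:
  assumes fin: "finite A" "finite B" and sb: "substitutes A u" "substitutes B v"
  shows "substitutes (A \<union> B) (merge_value A u B v)"
proof -
  define f where "f i = (if i \<in> A then Inl i else Inr i)" for i :: 'a
  have "f ` (A \<union> B) = A <+> (B - A \<inter> B)" by (auto simp: f_def image_iff)
  then have "substitutes (f ` (A \<union> B)) (partial_merge u v (A \<inter> B))"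
    using substitutes_partial_merge[OF fin sb subset_refl] by simp
  moreover have "inj_on f (A \<union> B)" by (auto simp: f_def inj_on_def)
  ultimately have "substitutes (A \<union> B) (\<lambda>S. partial_merge u v (A \<inter> B) (f ` S))"
    by (rule substitutes_rename[rotated])
  then show ?thesis
    using substitutes_cong[of "A \<union> B", OF merge_value_eq_partial_merge[of _ A B f]]
    by (simp add: f_def)
qed

lemma merge_value_ge:
  assumes "finite S" "T \<subseteq> S \<inter> A" "S - T \<subseteq> B"
  shows "u T + v (S - T) \<le> merge_value A u B v S"
  unfolding merge_value_def using assms by (intro Max_ge) auto

lemma merge_value_attained:
  assumes "finite S" "S \<subseteq> A \<union> B"
  obtains T where "T \<subseteq> S \<inter> A" "S - T \<subseteq> B" "merge_value A u B v S = u T + v (S - T)"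
proof -
  have "merge_value A u B v S \<in> {u T + v (S - T) | T. T \<subseteq> S \<inter> A \<and> S - T \<subseteq> B}"
    unfolding merge_value_def
  proof (rule Max_in)
    show "{u T + v (S - T) | T. T \<subseteq> S \<inter> A \<and> S - T \<subseteq> B} \<noteq> {}" using assms(2) by blast
  qed (use assms(1) in simp)
  then show thesis using that by blast
qed

lemma merge_value_commute: "merge_value A u B v = merge_value B v A u"
proof
  fix S
  have sub: "{u T + v (S - T) | T. T \<subseteq> S \<inter> A \<and> S - T \<subseteq> B} \<subseteq>
      {v T + u (S - T) | T. T \<subseteq> S \<inter> B \<and> S - T \<subseteq> A}" for A B and u v :: "'a set \<Rightarrow> real"
  proof
    fix z assume "z \<in> {u T + v (S - T) | T. T \<subseteq> S \<inter> A \<and> S - T \<subseteq> B}"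
    then obtain T where T: "T \<subseteq> S \<inter> A" "S - T \<subseteq> B" "z = u T + v (S - T)" by blast
    then have "S - (S - T) = T" by blast
    then show "z \<in> {v T + u (S - T) | T. T \<subseteq> S \<inter> B \<and> S - T \<subseteq> A}"
      using T by (intro CollectI exI[of _ "S - T"]) auto
  qed
  show "merge_value A u B v S = merge_value B v A u S"
    unfolding merge_value_def by (intro arg_cong[where f = Max] subset_antisym sub)
qed

lemma merge_value_mono:
  assumes u: "\<And>X Y. X \<subseteq> Y \<Longrightarrow> Y \<subseteq> A \<Longrightarrow> u X \<le> u Y" and v: "\<And>X Y. X \<subseteq> Y \<Longrightarrow> Y \<subseteq> B \<Longrightarrow> v X \<le> v Y"
    and S: "S \<subseteq> S'" "S' \<subseteq> A \<union> B" and fin: "finite S'"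
  shows "merge_value A u B v S \<le> merge_value A u B v S'"
proof -
  have "finite S" "S \<subseteq> A \<union> B" using S fin finite_subset by auto
  then obtain T where T: "T \<subseteq> S \<inter> A" "S - T \<subseteq> B" "merge_value A u B v S = u T + v (S - T)"
    by (rule merge_value_attained)
  define T' where "T' = T \<union> ((S' - S) \<inter> A)"
  have T': "T' \<subseteq> S' \<inter> A" "S' - T' \<subseteq> B" using T S by (auto simp: T'_def)
  have "u T \<le> u T'" using T' by (intro u) (auto simp: T'_def)
  moreover have "v (S - T) \<le> v (S' - T')" using T' S by (intro v) (auto simp: T'_def)
  ultimately show ?thesis using merge_value_ge[OF fin T', of u v] T(3) by linarith
qed

lemma merge_value_Un_ge:
  assumes "finite X" "finite Y" "X \<subseteq> A" "Y \<subseteq> B" "X \<inter> Y = {}"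
  shows "u X + v Y \<le> merge_value A u B v (X \<union> Y)"
proof -
  have "X \<union> Y - X = Y" using assms(5) by blast
  then show ?thesis using merge_value_ge[of "X \<union> Y" X A B u v] assms by simp
qed

lemma merge_value_pair_ge:
  assumes "i \<in> A" "j \<in> B" "i \<noteq> j"
  shows "u {i} + v {j} \<le> merge_value A u B v {i, j}"
  using merge_value_Un_ge[of "{i}" "{j}" A B u v] assms by (simp add: insert_commute)

lemma merge_value_singletonE:
  assumes "i \<in> A \<union> B" "u {} = 0" "v {} = 0"
  obtains "i \<in> A" "u {i} = merge_value A u B v {i}" | "i \<in> B" "v {i} = merge_value A u B v {i}"
proof -
  obtain T where T: "T \<subseteq> {i} \<inter> A" "{i} - T \<subseteq> B" "merge_value A u B v {i} = u T + v ({i} - T)"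
    by (rule merge_value_attained[of "{i}" A B u v]) (use assms(1) in auto)
  show thesis
  proof (cases "T = {}")
    case True
    then show thesis using that(2) T(2,3) assms(2) by simp
  next
    case False
    then have "T = {i}" using T(1) by blast
    then show thesis using that(1) T(1,3) assms(3) by simp
  qed
qed

section \<open>Closure of the gross substitutes valuations\<close>

lemma GSV_restrictI:
  assumes "E \<subseteq> {1..n}" "f {} = 0" "\<And>S T. S \<subseteq> T \<Longrightarrow> T \<subseteq> E \<Longrightarrow> f S \<le> f T" "substitutes E f"
  shows "(E, \<lambda>S\<in>Pow E. f S) \<in> GSV n"
proof -
  have "0 \<le> f S" if "S \<subseteq> E" for S using assms(2) assms(3)[of "{}" S] that by simp
  then have "valuation_on E (\<lambda>S\<in>Pow E. f S)"
    using assms(2,3) by (auto simp: valuation_on_def)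
  moreover have "substitutes E (\<lambda>S\<in>Pow E. f S)"
    using assms(4) substitutes_cong[of E "\<lambda>S\<in>Pow E. f S" f] by simp
  ultimately show ?thesis
    using assms(1) by (simp add: GSV_def gross_substitutes_iff_substitutes)
qed

lemma
  assumes "(E, u) \<in> GSV n"
  shows GSV_ground: "E \<subseteq> {1..n}"
    and GSV_finite: "finite E"
    and GSV_empty: "u {} = 0"
    and GSV_substitutes: "substitutes E u"
    and GSV_extensional: "u \<in> extensional (Pow E)"
    and GSV_mono: "\<And>S T. S \<subseteq> T \<Longrightarrow> T \<subseteq> E \<Longrightarrow> u S \<le> u T"
    and GSV_nonneg: "\<And>S. S \<subseteq> E \<Longrightarrow> 0 \<le> u S"
  using assms
  by (auto simp: GSV_def valuation_on_def gross_substitutes_iff_substitutes PiE_iff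
      intro: finite_subset)

lemma merge_eq: "merge (A, u) (B, v) = (A \<union> B, \<lambda>S\<in>Pow (A \<union> B). merge_value A u B v S)"
  by (simp add: merge_value_def)

lemma merge_commute: "merge u v = merge v u"
  by (cases u; cases v) (simp only: merge_eq merge_value_commute Un_commute)

lemma merge_in_GSV:
  assumes "u \<in> GSV n" "v \<in> GSV n"
  shows "merge u v \<in> GSV n"
proof -
  obtain A f B h where uv: "u = (A, f)" "v = (B, h)" by (cases u, cases v)
  have f: "(A, f) \<in> GSV n" and h: "(B, h) \<in> GSV n" using assms uv by auto
  note fin = GSV_finite[OF f] GSV_finite[OF h]
  have "(A \<union> B, \<lambda>S\<in>Pow (A \<union> B). merge_value A f B h S) \<in> GSV n"
  proof (rule GSV_restrictI)
    show "A \<union> B \<subseteq> {1..n}" using GSV_ground[OF f] GSV_ground[OF h] by blast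
    show "merge_value A f B h {} = 0"
      by (simp add: merge_value_def GSV_empty[OF f] GSV_empty[OF h])
    show "merge_value A f B h S \<le> merge_value A f B h T" if "S \<subseteq> T" "T \<subseteq> A \<union> B" for S T
    proof (rule merge_value_mono[OF GSV_mono[OF f] GSV_mono[OF h] that])
      show "finite T" using that(2) fin by (meson finite_Un finite_subset)
    qed
    show "substitutes (A \<union> B) (merge_value A f B h)"
      by (rule substitutes_merge_value[OF fin GSV_substitutes[OF f] GSV_substitutes[OF h]])
  qed
  then show ?thesis by (simp only: uv merge_eq)
qed

lemma endow_in_GSV:
  assumes "u \<in> GSV n" "T \<subseteq> fst u"
  shows "endow T u \<in> GSV n"
proof -
  obtain E f where u: "u = (E, f)" by (cases u)
  have f: "(E, f) \<in> GSV n" and T: "T \<subseteq> E" using assms u by auto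
  have "(E - T, \<lambda>S\<in>Pow (E - T). f (S \<union> T) - f T) \<in> GSV n"
  proof (rule GSV_restrictI)
    show "substitutes (E - T) (\<lambda>S. f (S \<union> T) - f T)"
      using substitutes_minor[OF GSV_finite[OF f] GSV_substitutes[OF f] T subset_refl] .
    show "f (A \<union> T) - f T \<le> f (B \<union> T) - f T" if "A \<subseteq> B" "B \<subseteq> E - T" for A B
      using that T GSV_mono[OF f, of "A \<union> T" "B \<union> T"] by auto
  qed (use GSV_ground[OF f] in auto)
  then show ?thesis by (simp add: u)
qed

lemma endow_eq_self_if_full_ground:
  assumes "u \<in> GSV n" "T \<subseteq> fst u" "fst (endow T u) = {1..n}"
  shows "endow T u = u"
proof -
  obtain E f where u: "u = (E, f)" by (cases u)
  have f: "(E, f) \<in> GSV n" using assms(1) u by simp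
  have "T \<subseteq> E" "E - T = {1..n}" using assms(2,3) by (simp_all add: u)
  then have "T = {}" using GSV_ground[OF f] by blast
  then have "endow T u = (E, restrict f (Pow E))" using GSV_empty[OF f] by (simp add: u)
  with GSV_extensional[OF f] show ?thesis by (simp only: u extensional_restrict)
qed

lemma weighted_rank_eq: "weighted_rank E \<I> w = (E, \<lambda>T\<in>Pow E. max_weight \<I> w T)"
  by (simp add: weighted_rank_def max_weight_def)

lemma weighted_ranks_subset_GSV: "weighted_ranks n \<subseteq> GSV n"
proof
  fix u assume "u \<in> weighted_ranks n"
  then obtain E \<I> w where u: "u = weighted_rank E \<I> w" and E: "E \<subseteq> {1..n}" and M: "matroid E \<I>"
    by (auto simp: weighted_ranks_def)
  note fin = matroid_finite_ground[OF M]
  have "(E, \<lambda>S\<in>Pow E. max_weight \<I> w S) \<in> GSV n"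
  proof (rule GSV_restrictI[OF E])
    show "max_weight \<I> w {} = 0"
      by (rule max_weight_attained[of "{}" \<I> w]) (use matroid_empty[OF M] in auto)
    show "max_weight \<I> w S \<le> max_weight \<I> w T" if "S \<subseteq> T" "T \<subseteq> E" for S T
      using max_weight_mono[OF finite_subset[OF that(2) fin] matroid_empty[OF M] that(1)] .
    show "substitutes E (max_weight \<I> w)"
      using substitutes_if_M_natural_concave[OF fin M_natural_concave_max_weight[OF M]] .
  qed
  then show "u \<in> GSV n" by (simp add: u weighted_rank_eq)
qed

definition colour_count_valuation :: "nat set \<Rightarrow> (nat \<Rightarrow> 'b) \<Rightarrow> (nat \<Rightarrow> real) \<Rightarrow> setfun" where
  "colour_count_valuation E c g = (E, \<lambda>S\<in>Pow E. g (card (c ` S)))"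

lemma colour_count_valuation_in_GSV:
  assumes E: "E \<subseteq> {1..n}" and g: "g 0 = 0" "mono g" "discretely_concave g"
  shows "colour_count_valuation E c g \<in> GSV n"
  unfolding colour_count_valuation_def
proof (rule GSV_restrictI[OF E])
  have fin: "finite E" using E finite_subset by blast
  show "substitutes E (\<lambda>S. g (card (c ` S)))"
    using substitutes_if_M_natural_concave[OF fin M_natural_concave_colour_count[OF fin g(2,3)]] .
  show "g (card (c ` S)) \<le> g (card (c ` T))" if "S \<subseteq> T" "T \<subseteq> E" for S T
    using that finite_subset[OF that(2) fin] by (intro monoD[OF g(2)] card_mono) auto
qed (simp add: g(1))

lemma subset_part_iff_card_image_eq_1:
  assumes part: "partition_on E \<pi>" and c: "\<And>i. i \<in> E \<Longrightarrow> c i \<in> \<pi> \<and> i \<in> c i"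
    and S: "S \<subseteq> E" "S \<noteq> {}"
  shows "(\<exists>B\<in>\<pi>. S \<subseteq> B) \<longleftrightarrow> card (c ` S) = 1"
proof
  have c_unique: "c i = B" if "i \<in> E" "B \<in> \<pi>" "i \<in> B" for i B
    using disjointD[OF partition_onD2[OF part]] c[OF that(1)] that(2,3) by blast
  {
    assume "\<exists>B\<in>\<pi>. S \<subseteq> B"
    then obtain B where B: "B \<in> \<pi>" "S \<subseteq> B" by blast
    then have "c i = B" if "i \<in> S" for i using c_unique S(1) that by blast
    then have "c ` S = {B}" using S(2) by (simp add: image_constant_conv cong: image_cong)
    then show "card (c ` S) = 1" by simp
  next
    assume "card (c ` S) = 1"
    then obtain B where B: "c ` S = {B}" by (rule card_1_singletonE)
    have B_part: "B \<in> \<pi>" "i \<in> B" if "i \<in> S" for i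
    proof -
      have "c i = B" using B that by (metis imageI singletonD)
      then show "B \<in> \<pi>" "i \<in> B" using c[of i] S(1) that by auto
    qed
    then show "\<exists>B\<in>\<pi>. S \<subseteq> B" using S(2) by (intro bexI[of _ B]) auto
  }
qed

lemma partition_valuation_eq_colour_count_valuation:
  assumes part: "partition_on E \<pi>" and fin: "finite E"
  obtains c :: "nat \<Rightarrow> nat set" where "partition_valuation E \<pi> a b =
    colour_count_valuation E c (\<lambda>k. if k = 0 then 0 else if k = 1 then a else b)"
proof -
  have "\<forall>i\<in>E. \<exists>B. B \<in> \<pi> \<and> i \<in> B" using partition_onD1[OF part] by blast
  then obtain c where c: "\<And>i. i \<in> E \<Longrightarrow> c i \<in> \<pi> \<and> i \<in> c i" by metis
  have "card (c ` S) = 0 \<longleftrightarrow> S = {}" if "S \<subseteq> E" for S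
    using finite_subset[OF that fin] by simp
  then show thesis
    using subset_part_iff_card_image_eq_1[OF part c]
    by (intro that[of c])
      (auto simp: partition_valuation_def colour_count_valuation_def intro!: restrict_ext)
qed

lemma partition_valuations_subset_GSV: "partition_valuations n \<subseteq> GSV n"
proof
  fix u assume "u \<in> partition_valuations n"
  then obtain E \<pi> a b where u: "u = partition_valuation E \<pi> a b" and E: "E \<subseteq> {1..n}"
    and part: "partition_on E \<pi>" and ab: "0 < a" "a < b" "b < 2 * a"
    by (auto simp: partition_valuations_def)
  define g where "g = (\<lambda>k :: nat. if k = 0 then 0 else if k = 1 then a else b)"
  have "finite E" using E finite_subset by blast
  with part obtain c :: "nat \<Rightarrow> nat set" where "u = colour_count_valuation E c g"
    unfolding u g_def by (rule partition_valuation_eq_colour_count_valuation)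
  moreover have "mono g" "discretely_concave g"
    using ab by (auto simp: g_def mono_def discretely_concave_def)
  ultimately show "u \<in> GSV n"
    using colour_count_valuation_in_GSV[OF E, of g c] by (simp add: g_def)
qed

section \<open>Irreducible valuations\<close>

lemma merge_null_right:
  assumes u: "(A, u) \<in> GSV n" and v: "(B, v) \<in> GSV n" and BA: "B \<subseteq> A"
    and null: "\<And>S. S \<subseteq> B \<Longrightarrow> v S = 0"
  shows "merge (A, u) (B, v) = (A, u)"
proof -
  have AB: "A \<union> B = A" using BA by blast
  have "merge_value A u B v S = u S" if S: "S \<subseteq> A" for S
  proof (rule antisym)
    have finS: "finite S" using S GSV_finite[OF u] finite_subset by blast
    then obtain T where T: "T \<subseteq> S \<inter> A" "S - T \<subseteq> B" "merge_value A u B v S = u T + v (S - T)"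
      using merge_value_attained S AB by metis
    then show "merge_value A u B v S \<le> u S" using null GSV_mono[OF u, of T S] S by simp
    show "u S \<le> merge_value A u B v S"
      using merge_value_Un_ge[OF finS _ S, of "{}" B u v] GSV_empty[OF v] by simp
  qed
  then have "(\<lambda>S\<in>Pow A. merge_value A u B v S) = restrict u (Pow A)" by (intro restrict_ext) auto
  then show ?thesis
    using GSV_extensional[OF u] by (simp add: merge_eq AB extensional_restrict del: merge.simps)
qed

lemma merge_factor_eq_if_singletons_eq:
  assumes u: "(A, u) \<in> GSV n" and v: "(B, v) \<in> GSV n" and eq: "(E, f) = merge (A, u) (B, v)"
    and single: "\<And>i. i \<in> E \<Longrightarrow> i \<in> A \<and> u {i} = a"
    and parallel: "\<And>j. j \<in> E \<Longrightarrow> \<exists>i\<in>E. i \<noteq> j \<and> f {i, j} = a"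
  shows "(E, f) = (A, u)"
proof -
  have E: "E = A \<union> B" and f: "\<And>S. S \<subseteq> E \<Longrightarrow> f S = merge_value A u B v S"
    using eq unfolding merge_eq by auto
  have "v {j} = 0" if j: "j \<in> B" for j
  proof -
    obtain i where i: "i \<in> E" "i \<noteq> j" "f {i, j} = a" using parallel j E by blast
    have ui: "i \<in> A" "u {i} = a" using single[OF i(1)] by simp_all
    then have "u {i} + v {j} \<le> f {i, j}"
      using merge_value_pair_ge[of i A j B u v] f[of "{i, j}"] i(2) j E by simp
    then show ?thesis using ui(2) i(3) GSV_nonneg[OF v, of "{j}"] j by simp
  qed
  then have "v S \<le> 0" if "S \<subseteq> B" for S
    using substitutes_le_sum_singletons[OF GSV_finite[OF v] GSV_substitutes[OF v] GSV_empty[OF v]]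
      that by (force simp: subset_iff)
  then have "v S = 0" if "S \<subseteq> B" for S using GSV_nonneg[OF v] that by (meson antisym)
  moreover have "B \<subseteq> A" using E single by blast
  ultimately have "merge (A, u) (B, v) = (A, u)" by (intro merge_null_right[OF u v])
  with eq show ?thesis by (rule trans)
qed

lemma irreducible_valuationI:
  assumes v: "(E, f) \<in> GSV n" and single: "\<And>i. i \<in> E \<Longrightarrow> f {i} = a"
    and pair: "\<And>i j. i \<in> E \<Longrightarrow> j \<in> E \<Longrightarrow> i \<noteq> j \<Longrightarrow> f {i, j} < 2 * a"
    and parallel: "\<And>j. j \<in> E \<Longrightarrow> \<exists>i\<in>E. i \<noteq> j \<and> f {i, j} = a"
  shows "irreducible_valuation n (E, f)"
proof -
  have "(E, f) = (A, u) \<or> (E, f) = (B, h)"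
    if u: "(A, u) \<in> GSV n" and h: "(B, h) \<in> GSV n" and eq: "(E, f) = merge (A, u) (B, h)"
    for A u B h
  proof -
    have E: "E = A \<union> B" and f: "\<And>S. S \<subseteq> E \<Longrightarrow> f S = merge_value A u B h S"
      using eq unfolding merge_eq by auto
    have from_factor: "(i \<in> A \<and> u {i} = a) \<or> (i \<in> B \<and> h {i} = a)" if i: "i \<in> E" for i
      using merge_value_singletonE[of i A B u h, OF _ GSV_empty[OF u] GSV_empty[OF h]]
        single[OF i] f[of "{i}"] i E by auto
    have same_factor: "i = j" if "i \<in> A" "u {i} = a" "j \<in> B" "h {j} = a" for i j
    proof (rule ccontr)
      assume "i \<noteq> j"
      then have "u {i} + h {j} \<le> f {i, j}"
        using merge_value_pair_ge[of i A j B u h] f[of "{i, j}"] that E by simp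
      then show False using pair[of i j] \<open>i \<noteq> j\<close> that E by auto
    qed
    have "(\<forall>i\<in>E. i \<in> A \<and> u {i} = a) \<or> (\<forall>i\<in>E. i \<in> B \<and> h {i} = a)"
      using from_factor same_factor parallel by metis
    then show ?thesis
      using merge_factor_eq_if_singletons_eq[OF u h eq _ parallel]
        merge_factor_eq_if_singletons_eq[OF h u _ _ parallel] eq merge_commute by metis
  qed
  then show ?thesis using v unfolding irreducible_valuation_def by fast
qed

lemma irreducible_colour_count_valuation:
  assumes E: "E \<subseteq> {1..n}" and g: "g 0 = 0" "mono g" "discretely_concave g" "g 2 < 2 * g 1"
    and repeated: "\<And>j. j \<in> E \<Longrightarrow> \<exists>i\<in>E. i \<noteq> j \<and> c i = c j"
  shows "irreducible_valuation n (colour_count_valuation E c g)"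
proof -
  define f where "f = (\<lambda>S\<in>Pow E. g (card (c ` S)))"
  have f: "f S = g (card (c ` S))" if "S \<subseteq> E" for S using that by (simp add: f_def)
  have "irreducible_valuation n (E, f)"
  proof (rule irreducible_valuationI)
    show "(E, f) \<in> GSV n"
      using colour_count_valuation_in_GSV[OF E g(1-3), of c]
      by (simp add: colour_count_valuation_def f_def)
    show "f {i} = g 1" if "i \<in> E" for i using f[of "{i}"] that by simp
    show "f {i, j} < 2 * g 1" if "i \<in> E" "j \<in> E" for i j
    proof -
      have "f {i, j} \<le> g 2"
        using f[of "{i, j}"] that monoD[OF g(2), of "card {c i, c j}" 2]
        by (simp add: card_insert_if)
      then show ?thesis using g(4) by simp
    qed
    show "\<exists>i\<in>E. i \<noteq> j \<and> f {i, j} = g 1" if "j \<in> E" for j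
    proof -
      obtain i where i: "i \<in> E" "i \<noteq> j" "c i = c j" using repeated[of j] \<open>j \<in> E\<close> by blast
      then have "f {i, j} = g 1" using f[of "{i, j}"] that by simp
      then show ?thesis using i by blast
    qed
  qed
  then show ?thesis by (simp add: colour_count_valuation_def f_def)
qed

lemma irreducible_not_generated:
  assumes irr: "irreducible_valuation n v" and full: "fst v = {1..n}"
    and basic: "v \<notin> weighted_ranks n" "v \<notin> partition_valuations n"
  shows "v \<notin> generated_valuations n"
proof -
  let ?X = "GSV n - {v}"
  have "closed_under_merging ?X"
    unfolding closed_under_merging_def
  proof (intro ballI)
    fix u u' assume u: "u \<in> ?X" "u' \<in> ?X"
    then have "u \<in> GSV n" "u' \<in> GSV n" "v \<noteq> u" "v \<noteq> u'" by auto
    then have "merge u u' \<noteq> v" using irr unfolding irreducible_valuation_def by metis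
    then show "merge u u' \<in> ?X" using merge_in_GSV u by blast
  qed
  moreover have "closed_under_endowment ?X"
    unfolding closed_under_endowment_def
  proof (intro ballI allI impI)
    fix u T assume u: "u \<in> ?X" and T: "T \<subseteq> fst u"
    then have "endow T u \<noteq> v" using endow_eq_self_if_full_ground[of u n T] full by auto
    then show "endow T u \<in> ?X" using endow_in_GSV u T by blast
  qed
  moreover have "weighted_ranks n \<subseteq> ?X" "partition_valuations n \<subseteq> ?X"
    using weighted_ranks_subset_GSV partition_valuations_subset_GSV basic by blast+
  ultimately show ?thesis unfolding generated_valuations_def by blast
qed

section \<open>Counting residues modulo 3\<close>

lemma weighted_rank_multiple_of_singletons:
  assumes "(E, f) \<in> weighted_ranks n" and S: "S \<subseteq> E" and single: "\<And>i. i \<in> S \<Longrightarrow> f {i} = a"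
  obtains k :: nat where "f S = real k * a"
proof -
  obtain \<I> w where M: "matroid E \<I>" and w: "\<forall>i\<in>E. 0 \<le> w i"
    and f: "f = (\<lambda>T\<in>Pow E. max_weight \<I> w T)"
    using assms(1) by (auto simp: weighted_ranks_def weighted_rank_eq)
  have "finite S" using S matroid_finite_ground[OF M] by (rule finite_subset)
  then obtain I where I: "I \<in> \<I>" "I \<subseteq> S" "max_weight \<I> w S = sum w I"
    using matroid_empty[OF M] by (rule max_weight_attained)
  have "w i = a" if i: "i \<in> I" for i
  proof -
    have iS: "i \<in> S" and iE: "i \<in> E" using i I(2) S by auto
    have "{i} \<in> \<I>" using matroid_hereditary[OF M I(1)] i by blast
    then have "w i \<le> max_weight \<I> w {i}" using max_weight_ge[of "{i}" "{i}" \<I> w] by simp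
    moreover obtain J where "J \<subseteq> {i}" "max_weight \<I> w {i} = sum w J"
      using max_weight_attained[of "{i}" \<I> w] matroid_empty[OF M] by blast
    then have "max_weight \<I> w {i} \<le> w i" using w iE by (auto simp: subset_singleton_iff)
    ultimately have "f {i} = w i" using iE by (simp add: f)
    then show ?thesis using single[OF iS] by simp
  qed
  then have "f S = real (card I) * a" using I(3) S by (simp add: f)
  then show thesis by (rule that)
qed

lemma partition_valuation_values:
  assumes "(E, f) \<in> partition_valuations n"
  obtains a b where "\<forall>S\<subseteq>E. f S \<in> {0, a, b}"
proof -
  obtain \<pi> a b where "f = (\<lambda>I\<in>Pow E. if I = {} then 0 else if \<exists>B\<in>\<pi>. I \<subseteq> B then a else b)"
    using assms by (auto simp: partition_valuations_def partition_valuation_def)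
  then have "\<forall>S\<subseteq>E. f S \<in> {0, a, b}" by simp
  then show thesis by (rule that)
qed

definition residue_value :: "nat set \<Rightarrow> real" where
  "residue_value S = 1 - (1 / 2) ^ card ((\<lambda>i. i mod 3) ` S)"

definition residue_valuation :: "nat \<Rightarrow> setfun" where
  "residue_valuation n = ({1..n}, \<lambda>S\<in>Pow {1..n}. residue_value S)"

lemma irreducible_residue_valuation:
  assumes "n \<ge> 6"
  shows "irreducible_valuation n (residue_valuation n)"
proof -
  define g :: "nat \<Rightarrow> real" where "g k = 1 - (1 / 2) ^ k" for k
  have "residue_valuation n = colour_count_valuation {1..n} (\<lambda>i. i mod 3) g"
    by (simp add: residue_valuation_def residue_value_def colour_count_valuation_def g_def)
  moreover have "irreducible_valuation n (colour_count_valuation {1..n} (\<lambda>i. i mod 3) g)"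
  proof (rule irreducible_colour_count_valuation)
    show "mono g" by (auto simp: g_def mono_def intro: power_decreasing)
    have "g (Suc k) - g k = (1 / 2) ^ Suc k" for k by (simp add: g_def)
    then show "discretely_concave g"
      by (simp add: discretely_concave_def power_decreasing del: power_Suc)
    fix j assume j: "j \<in> {1..n}"
    define i where "i = (if j \<le> 3 then j + 3 else j - 3)"
    have "i \<in> {1..n}" "i \<noteq> j" using j assms by (auto simp: i_def)
    moreover have "i mod 3 = j mod 3" by (simp add: i_def le_mod_geq)
    ultimately show "\<exists>i\<in>{1..n}. i \<noteq> j \<and> i mod 3 = j mod 3" by blast
  qed (simp_all add: g_def power2_eq_square)
  ultimately show ?thesis by simp
qed

lemma residue_value_samples:
  "residue_value {i} = 1 / 2" "residue_value {1, 2} = 3 / 4" "residue_value {1, 2, 3} = 7 / 8"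
  by (simp_all add: residue_value_def power2_eq_square power3_eq_cube)

lemma residue_valuation_notin_weighted_ranks:
  assumes "n \<ge> 2"
  shows "residue_valuation n \<notin> weighted_ranks n"
proof
  assume "residue_valuation n \<in> weighted_ranks n"
  then obtain k :: nat where "residue_value {1, 2} = real k * (1 / 2)"
    unfolding residue_valuation_def
    by (rule weighted_rank_multiple_of_singletons[of _ _ n "{1, 2}" "1 / 2"])
      (use assms in \<open>auto simp: residue_value_samples\<close>)
  then have "real 3 = real (2 * k)" by (simp add: residue_value_samples del: One_nat_def)
  then have "3 = 2 * k" by (simp only: of_nat_eq_iff)
  then show False by presburger
qed

lemma residue_valuation_notin_partition_valuations:
  assumes "n \<ge> 3"
  shows "residue_valuation n \<notin> partition_valuations n"
proof
  assume "residue_valuation n \<in> partition_valuations n"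
  then obtain a b where
    "\<forall>S\<subseteq>{1..n}. (\<lambda>S\<in>Pow {1..n}. residue_value S) S \<in> {0, a, b}"
    unfolding residue_valuation_def by (rule partition_valuation_values)
  then have "residue_value S \<in> {0, a, b}" if "S \<subseteq> {1..n}" for S
    using that by (metis Pow_iff restrict_apply')
  from this[of "{1}"] this[of "{1, 2}"] this[of "{1, 2, 3}"] show False
    using assms by (auto simp: residue_value_samples simp del: One_nat_def)
qed

theorem theorem1p4:
  fixes n :: nat
  assumes "n \<ge> 6"
  shows "\<exists>v\<in>GSV n. irreducible_valuation n v \<and> v \<notin> generated_valuations n"
proof (rule bexI)
  have irr: "irreducible_valuation n (residue_valuation n)"
    using assms by (rule irreducible_residue_valuation)
  moreover have "residue_valuation n \<notin> generated_valuations n"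
  proof (rule irreducible_not_generated[OF irr])
    show "fst (residue_valuation n) = {1..n}" by (simp add: residue_valuation_def)
    show "residue_valuation n \<notin> weighted_ranks n"
      using assms by (intro residue_valuation_notin_weighted_ranks) simp
    show "residue_valuation n \<notin> partition_valuations n"
      using assms by (intro residue_valuation_notin_partition_valuations) simp
  qed
  ultimately show "irreducible_valuation n (residue_valuation n) \<and>
    residue_valuation n \<notin> generated_valuations n" ..
  show "residue_valuation n \<in> GSV n" using irr by (simp add: irreducible_valuation_def)
qed

end
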